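(* Let $n\ge 1$ be an integer. A tree $T$ is an $n$-cube visibility graph if and only if $T$ is the union of $n$ subgraphs each of which is an $(n-1)$-cube orthogonal visibility forest.
   Context: All graphs are finite and simple. An $m$-cube is an $m$-dimensional (closed) unit hypercube; $\mathbf e_1,\mathbf e_2,\dots$ denote standard basis vectors. A graph $G$ is an $n$-cube visibility graph if its vertices can be assigned to pairwise disjoint axis-aligned unit $n$-cubes in $\mathbb{R}^n$ (one cube per vertex) such that two vertices are adjacent if and only if there is an uninterrupted axis-aligned cylindrical channel of positive diameter (parallel to some $\mathbf e_i$, $1\le i\le n$) between their cubes; uninterrupted means that it intersects none of the other cubes. A graph $G$ is an $m$-cube orthogonal visibility graph if its vertices can be assigned to pairwise disjoint unit $m$-cubes in $\mathbb{R}^{m+1}$ aligned with the first $m$ axes, i.e. sets of the form $\prod_{i=1}^m[a_i,a_i+1]\times\{c\}$ (one per vertex), such that two vertices are adjacent if and only if there is a cylindrical channel of positive diameter parallel to $\mathbf e_{m+1}$ between their cubes that intersects none of the other cubes. (For $m=0$ the objects are distinct points of $\mathbb{R}$, and two points see each other when no other point of the representation lies strictly between them.) An $m$-cube orthogonal visibility forest is a graph that is a disjoint union of trees each of which is an $m$-cube orthogonal visibility graph. *)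

theory Defs
  imports
    "HOL-Analysis.Abstract_Euclidean_Space"
    "HOL-Analysis.L2_Norm"
    "Graph_Theory.Graph_Theory"
begin

section \<open>Graphs and trees\<close>

text \<open>
  Finite simple graphs are represented by \<^locale>\<open>pair_graph\<close>: each edge occurs as
  the two opposite arcs \<open>(u, v)\<close> and \<open>(v, u)\<close>. Such a pair of arcs is a directed cycle of
  length 2, so that \<^const>\<open>Digraph_Component.tree\<close> is false for every graph with an edge.
  The cycles of the undirected graph are the directed cycles of length at least 3.
  The constant \<^const>\<open>Digraph_Component.connected\<close> requires a nonempty vertex set.
\<close>

definition is_tree :: "'a pair_pre_digraph \<Rightarrow> bool" where
  "is_tree G \<longleftrightarrow>
     pair_graph G \<and> Digraph_Component.connected (with_proj G) \<and>
     \<not> (\<exists>p. pre_digraph.cycle (with_proj G) p \<and> 3 \<le> length p)"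

definition graph_Union :: "'a pair_pre_digraph set \<Rightarrow> 'a pair_pre_digraph" where
  "graph_Union \<G> = \<lparr> pverts = (\<Union>H\<in>\<G>. pverts H), parcs = (\<Union>H\<in>\<G>. parcs H) \<rparr>"


section \<open>Cubes and channels\<close>

text \<open>
  Points of \<open>\<real>\<^sup>d\<close> are the functions \<^typ>\<open>nat \<Rightarrow> real\<close> that vanish from index \<open>d\<close> on, as in
  \<^const>\<open>Euclidean_space\<close>. The axes are numbered from 0 to \<open>d - 1\<close>.
\<close>

abbreviation points :: "nat \<Rightarrow> (nat \<Rightarrow> real) set" where
  "points d \<equiv> topspace (Euclidean_space d)"

definition unit_cubes :: "nat \<Rightarrow> (nat \<Rightarrow> real) set set" where
  "unit_cubes n = {{x \<in> points n. \<forall>i<n. x i \<in> {a i..a i + 1}} | a. True}"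

text \<open>Unit \<open>m\<close>-cubes in \<open>\<real>\<^sup>m\<^sup>+\<^sup>1\<close>, orthogonal to the last axis, which has index \<open>m\<close>.\<close>

definition flat_unit_cubes :: "nat \<Rightarrow> (nat \<Rightarrow> real) set set" where
  "flat_unit_cubes m =
     {{x \<in> points (Suc m). (\<forall>i<m. x i \<in> {a i..a i + 1}) \<and> x m = c} | a c. True}"

text \<open>
  The closed cylinder parallel to axis \<open>i\<close> whose two bases are the disc around \<open>p\<close> and its translate
  by \<open>h\<close>. For \<open>d = 1\<close> the disc is a point and the channel is a segment.
\<close>

definition disc :: "nat \<Rightarrow> nat \<Rightarrow> (nat \<Rightarrow> real) \<Rightarrow> real \<Rightarrow> (nat \<Rightarrow> real) set" where
  "disc d i p r = {x \<in> points d. x i = p i \<and> L2_set (\<lambda>j. x j - p j) {..<d} \<le> r}"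

definition channel :: "nat \<Rightarrow> nat \<Rightarrow> (nat \<Rightarrow> real) \<Rightarrow> real \<Rightarrow> real \<Rightarrow> (nat \<Rightarrow> real) set" where
  "channel d i p r h = {x(i := x i + t) | x t. x \<in> disc d i p r \<and> t \<in> {0..h}}"

text \<open>The channel leads from \<open>Q u\<close> to \<open>Q v\<close> in the positive direction of axis \<open>i\<close>.\<close>

definition channel_from_to ::
  "nat \<Rightarrow> nat \<Rightarrow> 'a set \<Rightarrow> ('a \<Rightarrow> (nat \<Rightarrow> real) set) \<Rightarrow> 'a \<Rightarrow> 'a \<Rightarrow> bool" where
  "channel_from_to d i V Q u v \<longleftrightarrow>
     (\<exists>p \<in> points d. \<exists>r>0. \<exists>h\<ge>0.
        disc d i p r \<subseteq> Q u \<and> disc d i (p(i := p i + h)) r \<subseteq> Q v \<and>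
        (\<forall>w \<in> V - {u, v}. channel d i p r h \<inter> Q w = {}))"

definition visible ::
  "nat \<Rightarrow> nat \<Rightarrow> 'a set \<Rightarrow> ('a \<Rightarrow> (nat \<Rightarrow> real) set) \<Rightarrow> 'a \<Rightarrow> 'a \<Rightarrow> bool" where
  "visible d i V Q u v \<longleftrightarrow> channel_from_to d i V Q u v \<or> channel_from_to d i V Q v u"


section \<open>Visibility graphs\<close>

definition cube_visibility_graph :: "nat \<Rightarrow> 'a pair_pre_digraph \<Rightarrow> bool" where
  "cube_visibility_graph n G \<longleftrightarrow>
     pair_graph G \<and>
     (\<exists>Q. (\<forall>v \<in> pverts G. Q v \<in> unit_cubes n) \<and>
          disjoint_family_on Q (pverts G) \<and>
          (\<forall>u \<in> pverts G. \<forall>v \<in> pverts G. u \<noteq> v \<longrightarrow>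
             ((u, v) \<in> parcs G \<longleftrightarrow> (\<exists>i<n. visible n i (pverts G) Q u v))))"

definition cube_orthogonal_visibility_graph :: "nat \<Rightarrow> 'a pair_pre_digraph \<Rightarrow> bool" where
  "cube_orthogonal_visibility_graph m G \<longleftrightarrow>
     pair_graph G \<and>
     (\<exists>Q. (\<forall>v \<in> pverts G. Q v \<in> flat_unit_cubes m) \<and>
          disjoint_family_on Q (pverts G) \<and>
          (\<forall>u \<in> pverts G. \<forall>v \<in> pverts G. u \<noteq> v \<longrightarrow>
             ((u, v) \<in> parcs G \<longleftrightarrow> visible (Suc m) m (pverts G) Q u v)))"

definition cube_orthogonal_visibility_forest :: "nat \<Rightarrow> 'a pair_pre_digraph \<Rightarrow> bool" where
  "cube_orthogonal_visibility_forest m G \<longleftrightarrow>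
     pair_graph G \<and>
     (\<exists>\<T>. (\<forall>H \<in> \<T>. is_tree H \<and> cube_orthogonal_visibility_graph m H) \<and>
          disjoint_family_on pverts \<T> \<and>
          G = graph_Union \<T>)"

end

theory Submission
  imports Defs
begin

text \<open>
  A generic line parallel to axis \<open>i\<close> meets the cubes in a sequence in which consecutive cubes see each
  other. Hence a cube outside a component of the graph of the visibilities along axis \<open>i\<close> never
  blocks a line between two cubes of that component, and each component, flattened along axis \<open>i\<close>,
  is an orthogonal visibility tree.

  Conversely, give each edge one of its colours. Since every edge of a tree is a bridge, the same
  argument shows that a connected part of an orthogonal visibility tree inherits its
  representation. The monochromatic components are then put together along the tree: a vertex is
  placed at the sum of the positions, in all components, of the points where the component is
  entered from that vertex. If the heights within the components are stretched by large generic
  factors, two vertices in no common component of colour \<open>i\<close> are far apart in some coordinate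
  other than \<open>i\<close>, so they neither see each other along axis \<open>i\<close> nor block such a line.
\<close>

section \<open>Bridges and classes of edges\<close>

text \<open>The reason behind the sum: every edge lies in exactly one class, and crossing it changes
  the gate in that class only. Inside a class \<open>C\<close> of colour \<open>i\<close> all other
  summands are constant, so \<open>C\<close> appears as a translate of its own representation in the
  axes other than \<open>i\<close>, with heights stretched by a positive factor along axis
  \<open>i\<close>. This is why an edge shared by several forests must keep a single colour.

  Heights must be injective on each class, because different gates in a class of colour
  \<open>k\<close> have to give a nonzero difference in coordinate \<open>k\<close>. Breaking ties
  is harmless: disjoint objects at equal height are more than 1 apart in some transverse axis, so no
  line runs through the shadows of both. Genericity keeps the contributions of several classes of
  one colour from cancelling, and one common factor \<open>M\<close> outweighs what the other
  colours add to that coordinate.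

  Acyclicity enters as the statement that every edge is a bridge, which turns all arguments about
  trees into arguments about reachability.\<close>

abbreviation without_edge :: "'a rel \<Rightarrow> 'a \<Rightarrow> 'a \<Rightarrow> 'a rel" where
  "without_edge E x y \<equiv> E - {(x, y), (y, x)}"

definition all_bridges :: "'a rel \<Rightarrow> bool" where
  "all_bridges E \<longleftrightarrow> (\<forall>x y. (x, y) \<in> E \<longrightarrow> (x, y) \<notin> (without_edge E x y)\<^sup>*)"

lemma rtrancl_first_entry:
  assumes "(x, y) \<in> R\<^sup>*" "x \<notin> C" "y \<in> C"
  obtains s t where "(s, t) \<in> R" "s \<notin> C" "t \<in> C" "(x, s) \<in> (R \<inter> (- C) \<times> (- C))\<^sup>*"
proof -
  have "\<exists>s t. (s, t) \<in> R \<and> s \<notin> C \<and> t \<in> C \<and> (x, s) \<in> (R \<inter> (- C) \<times> (- C))\<^sup>*"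
    using assms
  proof (induction rule: converse_rtrancl_induct)
    case base
    then show ?case by blast
  next
    case (step x x')
    show ?case
    proof (cases "x' \<in> C")
      case True
      then show ?thesis using step by blast
    next
      case False
      then obtain s t where st: "(s, t) \<in> R" "s \<notin> C" "t \<in> C" "(x', s) \<in> (R \<inter> (- C) \<times> (- C))\<^sup>*"
        using step by blast
      moreover have "(x, x') \<in> R \<inter> (- C) \<times> (- C)"
        using step False by blast
      ultimately show ?thesis
        by (meson converse_rtrancl_into_rtrancl)
    qed
  qed
  then show ?thesis using that by blast
qed

lemma rtrancl_symD: "sym R \<Longrightarrow> (x, y) \<in> R\<^sup>* \<Longrightarrow> (y, x) \<in> R\<^sup>*"
  by (meson sym_rtrancl symD)

lemma rtrancl_mono_in: "(x, y) \<in> R\<^sup>* \<Longrightarrow> R \<subseteq> S \<Longrightarrow> (x, y) \<in> S\<^sup>*"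
  using rtrancl_mono by blast

lemma sym_without_edge: "sym E \<Longrightarrow> sym (without_edge E x y)"
  by (auto simp: sym_def)

text \<open>
  Otherwise the edge through which a walk from \<open>x\<close> first enters the \<open>R\<close>-class of \<open>y\<close> would be
  a bridge outside \<open>R\<close> that separates \<open>x\<close> from \<open>y\<close>.
\<close>

lemma connected_in_subrelation:
  assumes "all_bridges E" "sym E" "sym R" "R \<subseteq> E" "(x, y) \<in> E\<^sup>*"
    and *: "\<And>s t. (s, t) \<in> E - R \<Longrightarrow> (x, y) \<in> (without_edge E s t)\<^sup>*"
  shows "(x, y) \<in> R\<^sup>*"
proof (rule ccontr)
  assume no: "(x, y) \<notin> R\<^sup>*"
  define C where "C = {z. (z, y) \<in> R\<^sup>*}"
  obtain s t where st: "(s, t) \<in> E" "s \<notin> C" "t \<in> C" "(x, s) \<in> (E \<inter> (- C) \<times> (- C))\<^sup>*"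
    using rtrancl_first_entry[OF \<open>(x, y) \<in> E\<^sup>*\<close>, of C] no by (auto simp: C_def)
  let ?D = "without_edge E s t"
  have nR: "(s, t) \<notin> R" "(t, s) \<notin> R"
    using st(2,3) \<open>sym R\<close> by (auto simp: C_def dest: symD intro: converse_rtrancl_into_rtrancl)
  have "(x, s) \<in> ?D\<^sup>*"
    by (rule rtrancl_mono_in[OF st(4)]) (use st(3) in auto)
  moreover have "(t, y) \<in> ?D\<^sup>*"
    by (rule rtrancl_mono_in[of _ _ R]) (use st(3) nR \<open>R \<subseteq> E\<close> in \<open>auto simp: C_def\<close>)
  moreover have "(x, y) \<in> ?D\<^sup>*"
    using *[of s t] st(1) nR by blast
  ultimately have "(s, t) \<in> ?D\<^sup>*"
    using rtrancl_symD[OF sym_without_edge[OF \<open>sym E\<close>]] by (meson rtrancl_trans)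
  then show False using \<open>all_bridges E\<close> st(1) by (auto simp: all_bridges_def)
qed

text \<open>Follow the walk in \<open>R\<close> up to its first arrival at \<open>y\<close>. The
  edge of arrival would not be a bridge: its other end reaches \<open>x\<close> without meeting
  \<open>y\<close>, and \<open>x\<close> reaches \<open>y\<close> outside \<open>R\<close>. This
  makes gates unique.\<close>

lemma disconnected_outside_subrelation:
  assumes "all_bridges E" "sym E" "sym R" "R \<subseteq> E" "(x, y) \<in> R\<^sup>*" "(x, y) \<in> (E - R)\<^sup>*"
  shows "x = y"
proof (rule ccontr)
  assume "x \<noteq> y"
  obtain s where s: "(s, y) \<in> R" "s \<noteq> y" "(x, s) \<in> (R \<inter> (- {y}) \<times> (- {y}))\<^sup>*"
    using rtrancl_first_entry[OF \<open>(x, y) \<in> R\<^sup>*\<close>, of "{y}"] \<open>x \<noteq> y\<close> by auto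
  let ?D = "without_edge E s y"
  have "(x, s) \<in> ?D\<^sup>*"
    by (rule rtrancl_mono_in[OF s(3)]) (use \<open>R \<subseteq> E\<close> in auto)
  moreover have "(x, y) \<in> ?D\<^sup>*"
    by (rule rtrancl_mono_in[OF assms(6)]) (use s(1) \<open>sym R\<close> in \<open>auto dest: symD\<close>)
  ultimately have "(s, y) \<in> ?D\<^sup>*"
    using rtrancl_symD[OF sym_without_edge[OF \<open>sym E\<close>]] by (meson rtrancl_trans)
  then show False using assms(1,4) s(1) by (auto simp: all_bridges_def)
qed

section \<open>Trees of the graph library as relations consisting of bridges\<close>

lemma pair_graphI:
  assumes "finite V" "S \<subseteq> V \<times> V" "sym S" "irrefl S"
  shows "pair_graph \<lparr>pverts = V, parcs = S\<rparr>"
  using assms finite_subset[OF assms(2)]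
  by unfold_locales (auto simp: symmetric_def irrefl_def)

lemma pair_graph_simps:
  assumes "pair_graph G"
  shows pair_graph_finite: "finite (pverts G)" and pair_graph_arcs: "parcs G \<subseteq> pverts G \<times> pverts G"
    and pair_graph_sym: "sym (parcs G)" and pair_graph_irrefl: "irrefl (parcs G)"
proof -
  interpret pair_graph G by fact
  show "finite (pverts G)" by (rule pair_finite_verts)
  show "parcs G \<subseteq> pverts G \<times> pverts G" using in_arcsD1 in_arcsD2 by auto
  show "sym (parcs G)" using arcs_symmetric by (auto simp: sym_def)
  show "irrefl (parcs G)" using pair_no_loops by (fastforce simp: irrefl_def)
qed

lemma mk_symmetric_pair_graph:
  assumes "pair_graph G"
  shows "mk_symmetric (with_proj G) = G"
  using pair_graph_sym[OF assms]
  by (auto simp: mk_symmetric_def sym_def intro!: pair_pre_digraph.equality)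

lemma connected_iff_rtrancl:
  assumes "pair_graph G"
  shows "Digraph_Component.connected (with_proj G) \<longleftrightarrow>
    pverts G \<noteq> {} \<and> (\<forall>u \<in> pverts G. \<forall>v \<in> pverts G. (u, v) \<in> (parcs G)\<^sup>*)"
proof -
  have "(u, v) \<in> rtrancl_on (pverts G) (parcs G) \<longleftrightarrow> (u, v) \<in> (parcs G)\<^sup>*"
    if "u \<in> pverts G" "v \<in> pverts G" for u v
    using that pair_graph_arcs[OF assms]
    by (auto intro: rtrancl_consistent_rtrancl_on dest: rtrancl_on_rtranclI)
  then show ?thesis
    unfolding Digraph_Component.connected_def mk_symmetric_pair_graph[OF assms]
      strongly_connected_def reachable_def
    by auto
qed

text \<open>A walk that avoids the edge shortens to a path, which the arc \<open>(y, x)\<close>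
  closes to a cycle. The path has at least two arcs, since the only arc from \<open>x\<close> to
  \<open>y\<close> was deleted; hence the cycle has length at least 3.\<close>

lemma tree_all_bridges:
  assumes "is_tree T"
  shows "all_bridges (parcs T)"
  unfolding all_bridges_def
proof (intro allI impI notI)
  fix x y
  assume xy: "(x, y) \<in> parcs T" and walk: "(x, y) \<in> (without_edge (parcs T) x y)\<^sup>*"
  interpret T: pair_graph T using assms by (simp add: is_tree_def)
  let ?T' = "\<lparr>pverts = pverts T, parcs = without_edge (parcs T) x y\<rparr>"
  interpret T': pair_wf_digraph ?T'
    by unfold_locales (auto dest: T.in_arcsD1 T.in_arcsD2)
  have "x \<in> pverts T" "y \<in> pverts T" "x \<noteq> y"
    using xy T.in_arcsD1 T.in_arcsD2 T.no_loops' by blast+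
  then have "(x, y) \<in> rtrancl_on (pverts T) (without_edge (parcs T) x y)"
    using walk T.in_arcsD2 by (intro rtrancl_consistent_rtrancl_on) auto
  then have "x \<rightarrow>\<^sup>*\<^bsub>with_proj ?T'\<^esub> y"
    by (simp add: reachable_def)
  then obtain p where p: "T'.apath x p y"
    using T'.reachable_apath by blast
  have "T.awalk y ((y, x) # p) y"
    using p xy \<open>x \<in> pverts T\<close> T.arcs_symmetric
    by (auto simp: T'.apath_def T'.awalk_def T.awalk_def T.in_arcsD2)
  moreover have "distinct (pawalk_verts x p)"
    using p by (simp add: T'.apath_def)
  ultimately have "T.cycle ((y, x) # p)"
    by (auto simp: T.cycle_def)
  moreover have "p \<noteq> []" "\<And>e. p \<noteq> [e]"
    using p \<open>x \<noteq> y\<close> by (auto simp: T'.apath_def T'.awalk_def)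
  then have "3 \<le> length ((y, x) # p)"
    by (cases p; cases "tl p") auto
  ultimately show False using assms by (auto simp: is_tree_def)
qed

lemma cycle_mono:
  assumes "pverts H \<subseteq> pverts G" "parcs H \<subseteq> parcs G" "pre_digraph.cycle (with_proj H) p"
  shows "pre_digraph.cycle (with_proj G) p"
  using assms
  by (auto simp: pre_digraph.cycle_def pre_digraph.awalk_def cas_with_proj_eq awalk_verts_with_proj_eq)

lemma is_tree_subgraph:
  assumes "is_tree T" "pair_graph H" "pverts H \<subseteq> pverts T" "parcs H \<subseteq> parcs T"
    and "pverts H \<noteq> {}" "\<And>u v. u \<in> pverts H \<Longrightarrow> v \<in> pverts H \<Longrightarrow> (u, v) \<in> (parcs H)\<^sup>*"
  shows "is_tree H"
  using assms cycle_mono[OF assms(3,4)] connected_iff_rtrancl[OF assms(2)]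
  unfolding is_tree_def by blast

text \<open>The connected component of \<open>v\<close>. Vertices of \<open>V\<close> without edges
  in \<open>R\<close> form singleton classes, so that the classes of every colour cover all of
  \<open>V\<close>.\<close>

definition edge_class :: "'a set \<Rightarrow> 'a rel \<Rightarrow> 'a \<Rightarrow> 'a set" where
  "edge_class V R v = {w \<in> V. (v, w) \<in> R\<^sup>*}"

lemma edge_class_self: "v \<in> V \<Longrightarrow> v \<in> edge_class V R v"
  by (simp add: edge_class_def)

lemma edge_class_eq:
  assumes "sym R" "(v, w) \<in> R\<^sup>*"
  shows "edge_class V R v = edge_class V R w"
  using assms(2) rtrancl_symD[OF assms] by (auto simp: edge_class_def intro: rtrancl_trans)

lemma edge_class_disjoint:
  assumes "sym R" "C \<in> edge_class V R ` V" "D \<in> edge_class V R ` V" "x \<in> C" "x \<in> D"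
  shows "C = D"
proof -
  obtain v w where "C = edge_class V R v" "D = edge_class V R w" using assms by blast
  with assms(4,5) show ?thesis
    using edge_class_eq[OF assms(1), of v x] edge_class_eq[OF assms(1), of w x]
    by (auto simp: edge_class_def)
qed

lemma edge_class_closed:
  assumes "R \<subseteq> V \<times> V" "C \<in> edge_class V R ` V" "x \<in> C" "(x, y) \<in> R"
  shows "y \<in> C"
  using assms by (auto simp: edge_class_def intro: rtrancl_into_rtrancl)

lemma rtrancl_restrict_closed:
  assumes "(x, y) \<in> R\<^sup>*" "x \<in> C" "\<And>u v. u \<in> C \<Longrightarrow> (u, v) \<in> R \<Longrightarrow> v \<in> C"
  shows "(x, y) \<in> (R \<inter> C \<times> C)\<^sup>* \<and> y \<in> C"
  using assms(1)
proof (induction rule: rtrancl_induct)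
  case (step y z)
  then have "(y, z) \<in> R \<inter> C \<times> C" using assms(3) by blast
  with step show ?case by (auto intro: rtrancl_into_rtrancl)
qed (simp add: assms(2))

lemma edge_class_connected:
  assumes "sym R" "R \<subseteq> V \<times> V" "C \<in> edge_class V R ` V" "x \<in> C" "y \<in> C"
  shows "(x, y) \<in> (R \<inter> C \<times> C)\<^sup>*"
proof -
  obtain v where "C = edge_class V R v" using assms(3) by blast
  then have "(v, x) \<in> R\<^sup>*" "(v, y) \<in> R\<^sup>*" using assms(4,5) by (auto simp: edge_class_def)
  then have "(x, y) \<in> R\<^sup>*" using rtrancl_symD[OF assms(1)] by (meson rtrancl_trans)
  then show ?thesis
    using rtrancl_restrict_closed[of x y R C] edge_class_closed[OF assms(2,3)] assms(4) by blast
qed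

section \<open>Cuboids and lines of sight\<close>

text \<open>The side lengths are a parameter so that full cubes (all sides 1) and flat cubes (side 0
  along the line of sight) share one analysis of channels.\<close>

definition cuboid :: "nat \<Rightarrow> (nat \<Rightarrow> real) \<Rightarrow> (nat \<Rightarrow> real) \<Rightarrow> (nat \<Rightarrow> real) set" where
  "cuboid d s a = {x \<in> points d. \<forall>j<d. x j \<in> {a j..a j + s j}}"

lemma cuboid_disjoint_iff:
  assumes "\<And>j. 0 \<le> s j"
  shows "cuboid d s a \<inter> cuboid d s b = {} \<longleftrightarrow> (\<exists>j<d. s j < \<bar>a j - b j\<bar>)"
proof
  assume "\<exists>j<d. s j < \<bar>a j - b j\<bar>"
  then obtain j where j: "j < d" "s j < \<bar>a j - b j\<bar>" by blast
  have False if "x \<in> cuboid d s a" "x \<in> cuboid d s b" for x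
  proof -
    have "x j \<in> {a j..a j + s j}" "x j \<in> {b j..b j + s j}" using that j(1) by (auto simp: cuboid_def)
    then show False using j(2) by auto
  qed
  then show "cuboid d s a \<inter> cuboid d s b = {}" by blast
next
  assume disj: "cuboid d s a \<inter> cuboid d s b = {}"
  show "\<exists>j<d. s j < \<bar>a j - b j\<bar>"
  proof (rule ccontr)
    assume "\<not> (\<exists>j<d. s j < \<bar>a j - b j\<bar>)"
    then have close: "\<bar>a j - b j\<bar> \<le> s j" if "j < d" for j using that by force
    \<comment> \<open>The componentwise maximum of the lower corners lies in both boxes; the value 0
      from index \<open>d\<close> on makes it a point of the space.\<close>
    let ?x = "\<lambda>j. if j < d then max (a j) (b j) else 0"
    have "?x \<in> points d" by (simp add: topspace_Euclidean_space)
    moreover have "max (a j) (b j) \<in> {a j..a j + s j}" "max (a j) (b j) \<in> {b j..b j + s j}"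
      if "j < d" for j
      using close[OF that] assms[of j] by (auto simp: max_def)
    ultimately have "?x \<in> cuboid d s a \<inter> cuboid d s b" unfolding cuboid_def by auto
    then show False using disj by blast
  qed
qed

lemma disc_coord:
  assumes "x \<in> disc d i p r" "j < d"
  shows "\<bar>x j - p j\<bar> \<le> r"
proof -
  have "\<bar>x j - p j\<bar> \<le> L2_set (\<lambda>j. \<bar>x j - p j\<bar>) {..<d}"
    using member_le_L2_set[of "{..<d}" j "\<lambda>j. \<bar>x j - p j\<bar>"] assms(2) by simp
  also have "\<dots> = L2_set (\<lambda>j. x j - p j) {..<d}" by (simp add: L2_set_def)
  also have "\<dots> \<le> r" using assms(1) by (simp add: disc_def)
  finally show ?thesis .
qed

lemma disc_axis:
  assumes "p \<in> points d" "j < d" "j \<noteq> i" "\<bar>t\<bar> \<le> r"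
  shows "p(j := p j + t) \<in> disc d i p r"
proof -
  have "L2_set (\<lambda>k. (p(j := p j + t)) k - p k) {..<d} \<le> (\<Sum>k<d. \<bar>(p(j := p j + t)) k - p k\<bar>)"
    by (rule L2_set_le_sum_abs)
  also have "\<dots> = (\<Sum>k<d. if k = j then \<bar>t\<bar> else 0)" by (rule sum.cong) auto
  also have "\<dots> = \<bar>t\<bar>" using assms(2) by simp
  finally show ?thesis using assms by (auto simp: disc_def topspace_Euclidean_space)
qed

lemma disc_center: "p \<in> points d \<Longrightarrow> 0 \<le> r \<Longrightarrow> p \<in> disc d i p r"
  by (simp add: disc_def L2_set_def)

section \<open>Visibility as a condition on corners and heights\<close>

definition in_shadow :: "nat set \<Rightarrow> ('a \<Rightarrow> nat \<Rightarrow> real) \<Rightarrow> 'a \<Rightarrow> (nat \<Rightarrow> real) \<Rightarrow> bool" where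
  "in_shadow J a w p \<longleftrightarrow> (\<forall>j\<in>J. a w j \<le> p j \<and> p j \<le> a w j + 1)"

text \<open>Here \<open>p\<close> stands for a line of sight, and its coordinates outside
  \<open>J\<close> are ignored. The ends of a channel of positive diameter need the open shadow,
  whereas an object blocks already when the line touches its boundary, hence the closed one.\<close>

definition in_open_shadow :: "nat set \<Rightarrow> ('a \<Rightarrow> nat \<Rightarrow> real) \<Rightarrow> 'a \<Rightarrow> (nat \<Rightarrow> real) \<Rightarrow> bool" where
  "in_open_shadow J a w p \<longleftrightarrow> (\<forall>j\<in>J. a w j < p j \<and> p j < a w j + 1)"

text \<open>
  Visibility without channels: \<open>J\<close> is the set of the axes orthogonal to the line of sight,
  \<open>a\<close> assigns to each object its minimal corner and \<open>h\<close> its position along the line of sight.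
\<close>

definition sees ::
  "nat set \<Rightarrow> ('a \<Rightarrow> nat \<Rightarrow> real) \<Rightarrow> ('a \<Rightarrow> real) \<Rightarrow> 'a set \<Rightarrow> 'a \<Rightarrow> 'a \<Rightarrow> bool" where
  "sees J a h V u v \<longleftrightarrow> h u < h v \<and>
     (\<exists>p. in_open_shadow J a u p \<and> in_open_shadow J a v p \<and>
          (\<forall>w\<in>V. h u < h w \<longrightarrow> h w < h v \<longrightarrow> \<not> in_shadow J a w p))"

definition sight_rel ::
  "nat set \<Rightarrow> ('a \<Rightarrow> nat \<Rightarrow> real) \<Rightarrow> ('a \<Rightarrow> real) \<Rightarrow> 'a set \<Rightarrow> 'a rel" where
  "sight_rel J a h V = {(u, v) \<in> V \<times> V. sees J a h V u v \<or> sees J a h V v u}"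

text \<open>Disjointness of flat cubes: only those at equal height can intersect at all.\<close>

definition separated :: "nat set \<Rightarrow> ('a \<Rightarrow> nat \<Rightarrow> real) \<Rightarrow> ('a \<Rightarrow> real) \<Rightarrow> 'a set \<Rightarrow> bool" where
  "separated J a h V \<longleftrightarrow> (\<forall>u\<in>V. \<forall>v\<in>V. u \<noteq> v \<longrightarrow> h u = h v \<longrightarrow> (\<exists>j\<in>J. 1 < \<bar>a u j - a v j\<bar>))"

lemma sym_sight_rel: "sym (sight_rel J a h V)"
  by (auto simp: sight_rel_def sym_def)

lemma irrefl_sight_rel: "irrefl (sight_rel J a h V)"
  by (auto simp: sight_rel_def irrefl_def sees_def)

lemma shadow_overlap:
  assumes "in_open_shadow J a u p" "in_shadow J a w p" "j \<in> J"
  shows "\<bar>a u j - a w j\<bar> < 1"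
  using assms by (force simp: in_open_shadow_def in_shadow_def)

lemma in_open_shadow_imp: "in_open_shadow J a w p \<Longrightarrow> in_shadow J a w p"
  by (force simp: in_open_shadow_def in_shadow_def)

lemma sees_overlap:
  assumes "sees J a h V u v" "j \<in> J"
  shows "\<bar>a u j - a v j\<bar> < 1"
  using assms shadow_overlap in_open_shadow_imp by (metis sees_def)

lemma eventually_at_right_0_less: "0 < c \<Longrightarrow> \<forall>\<^sub>F r in at_right (0::real). r < c"
  using eventually_at_right_real[of 0 c] by (auto elim: eventually_mono)

text \<open>The centre line of the channel runs through the open shadows of both ends, so the two
  boxes can be disjoint only along axis \<open>i\<close>, and this fixes their order. A box with an
  intermediate corner whose shadow contains the line would be hit by the channel.\<close>

lemma channel_imp_sees:
  assumes "i < d" "0 \<le> s i" "\<And>j. j \<noteq> i \<Longrightarrow> s j = 1"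
    and Q: "\<And>v. v \<in> V \<Longrightarrow> Q v = cuboid d s (a v)" and "disjoint_family_on Q V"
    and uv: "u \<in> V" "v \<in> V" "u \<noteq> v" and "channel_from_to d i V Q u v"
  shows "sees ({..<d} - {i}) a (\<lambda>v. a v i) V u v"
proof -
  let ?J = "{..<d} - {i}"
  obtain p r h where p: "p \<in> points d" and "0 < r" "0 \<le> h"
    and pu: "disc d i p r \<subseteq> cuboid d s (a u)" and pv: "disc d i (p(i := p i + h)) r \<subseteq> cuboid d s (a v)"
    and free: "\<And>w. w \<in> V - {u, v} \<Longrightarrow> channel d i p r h \<inter> cuboid d s (a w) = {}"
    using assms(9) Q uv unfolding channel_from_to_def by (metis DiffE)
  have p': "p(i := p i + h) \<in> points d" using p \<open>i < d\<close> by (auto simp: topspace_Euclidean_space)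
  have inner: "in_open_shadow ?J a w q"
    if "q \<in> points d" "disc d i q r \<subseteq> cuboid d s (a w)" for w q
    unfolding in_open_shadow_def
  proof
    fix j assume "j \<in> ?J"
    then have "j < d" "j \<noteq> i" by auto
    then have "q(j := q j + r) \<in> cuboid d s (a w)" "q(j := q j + (- r)) \<in> cuboid d s (a w)"
      using disc_axis[OF that(1), of j i r r] disc_axis[OF that(1), of j i "- r" r]
        that(2) \<open>0 < r\<close> by (simp_all add: subset_iff)
    then have "q j + r \<le> a w j + 1" "a w j \<le> q j - r"
      using \<open>j < d\<close> assms(3)[OF \<open>j \<noteq> i\<close>] by (force simp: cuboid_def)+
    then show "a w j < q j \<and> q j < a w j + 1" using \<open>0 < r\<close> by auto
  qed
  have iu: "in_open_shadow ?J a u p" using inner[OF p pu] .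
  have "in_open_shadow ?J a v (p(i := p i + h))" using inner[OF p' pv] .
  then have iv: "in_open_shadow ?J a v p" by (simp add: in_open_shadow_def)
  have "p \<in> cuboid d s (a u)" "p(i := p i + h) \<in> cuboid d s (a v)"
    using pu pv disc_center p p' \<open>0 < r\<close> by (meson less_imp_le subsetD)+
  then have hu: "a u i \<le> p i" "p i \<le> a u i + s i" and hv: "a v i \<le> p i + h" "p i + h \<le> a v i + s i"
    using \<open>i < d\<close> by (auto simp: cuboid_def)
  have "cuboid d s (a u) \<inter> cuboid d s (a v) = {}"
    using assms(5) uv Q by (auto simp: disjoint_family_on_def)
  moreover have s0: "0 \<le> s j" for j using assms(2,3) by (cases "j = i") auto
  ultimately obtain j where j: "j < d" "s j < \<bar>a u j - a v j\<bar>"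
    by (auto simp: cuboid_disjoint_iff)
  then have "j = i"
    using shadow_overlap[OF iu in_open_shadow_imp[OF iv], of j] assms(3)[of j] by force
  with j have apart: "s i < \<bar>a u i - a v i\<bar>" by simp
  then have "a u i < a v i" using hu hv \<open>0 \<le> h\<close> by linarith
  moreover have "\<not> in_shadow ?J a w p" if w: "w \<in> V" "a u i < a w i" "a w i < a v i" for w
  proof
    assume shadow: "in_shadow ?J a w p"
    \<comment> \<open>The height at which the centre line meets \<open>w\<close>: its own start, or
      the lower face of \<open>w\<close> if that comes later.\<close>
    define z where "z = max (p i) (a w i)"
    have z: "p i \<le> z" "z \<le> p i + h" "a w i \<le> z" "z \<le> a w i + s i"
      using hu hv w(2,3) \<open>0 \<le> h\<close> s0[of i] by (auto simp: z_def)
    let ?x = "p(i := p i + (z - p i))"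
    have "?x \<in> channel d i p r h"
      unfolding channel_def using disc_center[OF p, of r i] \<open>0 < r\<close> z
      by (intro CollectI exI[of _ p] exI[of _ "z - p i"]) auto
    moreover have "?x \<in> cuboid d s (a w)"
      using shadow z p \<open>i < d\<close> assms(3)
      by (auto simp: cuboid_def in_shadow_def topspace_Euclidean_space)
    ultimately show False using free[of w] w by auto
  qed
  ultimately show ?thesis using iu iv unfolding sees_def by blast
qed

text \<open>The line satisfies finitely many strict inequalities, so it can be thickened by a small
  radius; the filter \<open>at_right 0\<close> supplies one radius that suits all of them.\<close>

lemma sees_imp_channel:
  assumes "i < d" "0 \<le> s i" "\<And>j. j \<noteq> i \<Longrightarrow> s j = 1" and "finite V"
    and Q: "\<And>v. v \<in> V \<Longrightarrow> Q v = cuboid d s (a v)" and "disjoint_family_on Q V"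
    and uv: "u \<in> V" "v \<in> V" and "sees ({..<d} - {i}) a (\<lambda>v. a v i) V u v"
  shows "channel_from_to d i V Q u v"
proof -
  let ?J = "{..<d} - {i}"
  obtain p where "a u i < a v i" and iu: "in_open_shadow ?J a u p" and iv: "in_open_shadow ?J a v p"
    and free: "\<And>w. w \<in> V \<Longrightarrow> a u i < a w i \<Longrightarrow> a w i < a v i \<Longrightarrow> \<not> in_shadow ?J a w p"
    using assms(9) unfolding sees_def by blast
  have s0: "0 \<le> s j" for j using assms(2,3) by (cases "j = i") auto
  have far: "\<exists>j<d. s j < \<bar>a x j - a y j\<bar>" if "x \<in> V" "y \<in> V" "x \<noteq> y" for x y
    using assms(6) that Q cuboid_disjoint_iff[of s d "a x" "a y", OF s0]
    by (auto simp: disjoint_family_on_def)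
  have overlap_far: "s i < \<bar>a x i - a y i\<bar>"
    if "x \<in> V" "y \<in> V" "x \<noteq> y" "in_open_shadow ?J a x p" "in_shadow ?J a y p" for x y
  proof -
    from far[OF that(1-3)] obtain j where j: "j < d" "s j < \<bar>a x j - a y j\<bar>" by blast
    then have "j = i" using shadow_overlap[OF that(4,5), of j] assms(3)[of j] by force
    then show ?thesis using j by simp
  qed
  have "u \<noteq> v" using \<open>a u i < a v i\<close> by blast
  have gap: "a u i + s i < a v i"
    using overlap_far[OF uv \<open>u \<noteq> v\<close> iu in_open_shadow_imp[OF iv]] \<open>a u i < a v i\<close> by linarith
  \<comment> \<open>\<open>free\<close> speaks only of corners strictly in between. Ties with
    \<open>u\<close> or \<open>v\<close> are excluded by disjointness, since boxes whose shadows
    share the line differ by more than \<open>s i\<close> along axis \<open>i\<close>.\<close>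
  have out: "\<exists>j\<in>?J. p j < a w j \<or> a w j + 1 < p j"
    if w: "w \<in> V - {u, v}" "a u i \<le> a w i" "a w i \<le> a v i" for w
  proof -
    have "\<not> in_shadow ?J a w p"
    proof
      assume "in_shadow ?J a w p"
      then have "s i < \<bar>a u i - a w i\<bar>" "s i < \<bar>a v i - a w i\<bar>"
        using overlap_far iu iv uv w(1) by auto
      then show False using free[of w] w s0[of i] \<open>in_shadow ?J a w p\<close> by auto
    qed
    then show ?thesis by (auto simp: in_shadow_def not_le)
  qed
  have ev1: "\<forall>\<^sub>F r in at_right 0. \<forall>j\<in>?J. a w j \<le> p j - r \<and> p j + r \<le> a w j + 1"
    if "in_open_shadow ?J a w p" for w
  proof (intro eventually_ball_finite ballI eventually_conj)
    fix j assume "j \<in> ?J"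
    then have "0 < p j - a w j" "0 < a w j + 1 - p j" using that by (auto simp: in_open_shadow_def)
    note ev = this[THEN eventually_at_right_0_less]
    show "\<forall>\<^sub>F r in at_right 0. a w j \<le> p j - r" by (rule eventually_mono[OF ev(1)]) simp
    show "\<forall>\<^sub>F r in at_right 0. p j + r \<le> a w j + 1" by (rule eventually_mono[OF ev(2)]) simp
  qed simp
  have ev2: "\<forall>\<^sub>F r in at_right 0. \<forall>w \<in> {w \<in> V - {u, v}. a u i \<le> a w i \<and> a w i \<le> a v i}.
      \<exists>j\<in>?J. p j + r < a w j \<or> a w j + 1 < p j - r"
  proof (intro eventually_ball_finite ballI)
    fix w assume "w \<in> {w \<in> V - {u, v}. a u i \<le> a w i \<and> a w i \<le> a v i}"
    then obtain j where j: "j \<in> ?J" "p j < a w j \<or> a w j + 1 < p j" using out by blast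
    from this(2) show "\<forall>\<^sub>F r in at_right 0. \<exists>j\<in>?J. p j + r < a w j \<or> a w j + 1 < p j - r"
    proof
      assume "p j < a w j"
      then have "\<forall>\<^sub>F r in at_right 0. r < a w j - p j" by (intro eventually_at_right_0_less) simp
      then show ?thesis using j(1) by (auto elim!: eventually_mono intro!: bexI[of _ j])
    next
      assume "a w j + 1 < p j"
      then have "\<forall>\<^sub>F r in at_right 0. r < p j - (a w j + 1)" by (intro eventually_at_right_0_less) simp
      then show ?thesis using j(1) by (auto elim!: eventually_mono intro!: bexI[of _ j])
    qed
  qed (simp add: \<open>finite V\<close>)
  have "\<forall>\<^sub>F r in at_right (0::real). 0 < r" by (simp add: eventually_at_right_less)
  from eventually_happens[OF eventually_conj[OF this
      eventually_conj[OF ev2 eventually_conj[OF ev1[OF iu] ev1[OF iv]]]]]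
  obtain r where r: "0 < r"
    and rw: "\<And>w. w \<in> V - {u, v} \<Longrightarrow> a u i \<le> a w i \<Longrightarrow> a w i \<le> a v i \<Longrightarrow>
      \<exists>j\<in>?J. p j + r < a w j \<or> a w j + 1 < p j - r"
    and ru: "\<And>j. j \<in> ?J \<Longrightarrow> a u j \<le> p j - r \<and> p j + r \<le> a u j + 1"
    and rv: "\<And>j. j \<in> ?J \<Longrightarrow> a v j \<le> p j - r \<and> p j + r \<le> a v j + 1"
    by (auto simp: trivial_limit_at_right_real)
  \<comment> \<open>The channel starts on the upper face of \<open>u\<close>, and its length
    \<open>h\<close> is the gap to the lower face of \<open>v\<close>. Hence it can only reach boxes
    with \<open>a u i \<le> a w i\<close> and \<open>a w i \<le> a v i\<close>.\<close>
  define q where "q = (\<lambda>j. if j = i then a u i + s i else if j < d then p j else 0)"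
  define h where "h = a v i - (a u i + s i)"
  have q: "q \<in> points d" using \<open>i < d\<close> by (auto simp: q_def topspace_Euclidean_space)
  have inside: "disc d i c r \<subseteq> cuboid d s (a w)"
    if c: "\<And>j. j \<in> ?J \<Longrightarrow> c j = p j" "a w i \<le> c i" "c i \<le> a w i + s i"
      and w: "\<And>j. j \<in> ?J \<Longrightarrow> a w j \<le> p j - r \<and> p j + r \<le> a w j + 1" for c w
  proof
    fix x assume x: "x \<in> disc d i c r"
    have "x j \<in> {a w j..a w j + s j}" if "j < d" for j
    proof (cases "j = i")
      case True
      then show ?thesis using x c by (simp add: disc_def)
    next
      case False
      then have "\<bar>x j - p j\<bar> \<le> r" using disc_coord[OF x that] c(1)[of j] that by simp
      then show ?thesis using w[of j] that False assms(3)[OF False] by auto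
    qed
    then show "x \<in> cuboid d s (a w)" using x by (simp add: cuboid_def disc_def)
  qed
  have "disc d i q r \<subseteq> Q u" "disc d i (q(i := q i + h)) r \<subseteq> Q v"
    using inside[of q u] inside[of "q(i := q i + h)" v] ru rv Q uv s0[of i]
    by (auto simp: q_def h_def)
  moreover have "channel d i q r h \<inter> Q w = {}" if w: "w \<in> V - {u, v}" for w
  proof -
    have False if "x \<in> disc d i q r" "0 \<le> t" "t \<le> h" and xw: "x(i := x i + t) \<in> cuboid d s (a w)" for x t
    proof -
      have "x i = a u i + s i" using that(1) by (simp add: disc_def q_def)
      moreover have "a w i \<le> x i + t" "x i + t \<le> a w i + s i"
        using xw \<open>i < d\<close> by (auto simp: cuboid_def)
      ultimately have "a u i \<le> a w i" "a w i \<le> a v i" using that(2,3) by (auto simp: h_def)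
      then obtain j where j: "j \<in> ?J" "p j + r < a w j \<or> a w j + 1 < p j - r" using rw w by blast
      then have "\<bar>x j - p j\<bar> \<le> r" using disc_coord[OF that(1), of j] by (simp add: q_def)
      moreover have "a w j \<le> x j" "x j \<le> a w j + 1"
        using xw j(1) assms(3)[of j] by (auto simp: cuboid_def dest!: spec[of _ j])
      ultimately show False using j(2) by linarith
    qed
    then show ?thesis using Q[of w] w by (auto simp: channel_def)
  qed
  moreover have "0 \<le> h" using gap by (simp add: h_def)
  ultimately show ?thesis unfolding channel_from_to_def using q r by blast
qed

lemma visible_iff_sight_rel:
  assumes "i < d" "0 \<le> s i" "\<And>j. j \<noteq> i \<Longrightarrow> s j = 1" and "finite V"
    and "\<And>v. v \<in> V \<Longrightarrow> Q v = cuboid d s (a v)" and "disjoint_family_on Q V"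
    and "u \<in> V" "v \<in> V" "u \<noteq> v"
  shows "visible d i V Q u v \<longleftrightarrow> (u, v) \<in> sight_rel ({..<d} - {i}) a (\<lambda>v. a v i) V"
  using channel_imp_sees[OF assms(1-3,5,6), of u v] channel_imp_sees[OF assms(1-3,5,6), of v u]
    sees_imp_channel[OF assms(1-6), of u v] sees_imp_channel[OF assms(1-6), of v u] assms(7-9)
  by (auto simp: visible_def sight_rel_def)

section \<open>Generic lines and the chains of visibilities along them\<close>

lemma sees_generic:
  assumes "finite J" "finite W" "finite C" "sees J a h C u v"
  obtains p where "in_open_shadow J a u p" "in_open_shadow J a v p"
    "\<And>w. w \<in> C \<Longrightarrow> h u < h w \<Longrightarrow> h w < h v \<Longrightarrow> \<not> in_shadow J a w p"
    "\<And>w. w \<in> W \<Longrightarrow> in_shadow J a w p \<Longrightarrow> in_open_shadow J a w p"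
proof -
  obtain p where iu: "in_open_shadow J a u p" and iv: "in_open_shadow J a v p"
    and free: "\<And>w. w \<in> C \<Longrightarrow> h u < h w \<Longrightarrow> h w < h v \<Longrightarrow> \<not> in_shadow J a w p"
    using assms(4) unfolding sees_def by blast
  have less: "\<forall>\<^sub>F t in at_right 0. p j + t < c" if "p j < c" for j c
    using eventually_at_right_0_less[of "c - p j"] that by (auto elim!: eventually_mono)
  have greater: "\<forall>\<^sub>F t in at_right 0. c < p j + t" if "c \<le> p j" for j c
    using eventually_at_right_less[of "0::real"] that by (auto elim!: eventually_mono)
  \<comment> \<open>All axes are shifted by the same small \<open>t > 0\<close>. Lying in an open
    shadow and missing a closed one are open conditions and survive; each of the finitely many faces
    is avoided as soon as \<open>t\<close> is small and positive.\<close>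
  have ev1: "\<forall>\<^sub>F t in at_right 0. in_open_shadow J a w (\<lambda>j. p j + t)"
    if "in_open_shadow J a w p" for w
    unfolding in_open_shadow_def
    by (intro eventually_ball_finite ballI eventually_conj less greater)
      (use that assms(1) in \<open>auto simp: in_open_shadow_def\<close>)
  have neq: "\<forall>\<^sub>F t in at_right 0. p j + t \<noteq> c" for j c
    using less[of j c] greater[of c j] by (cases "p j < c") (auto elim!: eventually_mono)
  have ev2: "\<forall>\<^sub>F t in at_right 0. \<forall>w\<in>W. \<forall>j\<in>J. p j + t \<noteq> a w j \<and> p j + t \<noteq> a w j + 1"
    by (intro eventually_ball_finite ballI eventually_conj neq) (use assms in auto)
  have ev3: "\<forall>\<^sub>F t in at_right 0. \<forall>w\<in>{w \<in> C. h u < h w \<and> h w < h v}. \<not> in_shadow J a w (\<lambda>j. p j + t)"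
  proof (intro eventually_ball_finite ballI)
    fix w assume "w \<in> {w \<in> C. h u < h w \<and> h w < h v}"
    then obtain j where j: "j \<in> J" "p j < a w j \<or> a w j + 1 < p j"
      using free[of w] by (auto simp: in_shadow_def not_le)
    then have "\<forall>\<^sub>F t in at_right 0. p j + t < a w j \<or> a w j + 1 < p j + t"
      using less[of j "a w j"] greater[of "a w j + 1" j] by (auto elim!: eventually_mono)
    then show "\<forall>\<^sub>F t in at_right 0. \<not> in_shadow J a w (\<lambda>j. p j + t)"
      by (rule eventually_mono) (use j(1) in \<open>force simp: in_shadow_def\<close>)
  qed (simp add: assms)
  from eventually_happens[OF eventually_conj[OF ev3
      eventually_conj[OF ev2 eventually_conj[OF ev1[OF iu] ev1[OF iv]]]]]
  obtain t where t: "in_open_shadow J a u (\<lambda>j. p j + t)" "in_open_shadow J a v (\<lambda>j. p j + t)"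
    "\<And>w. w \<in> C \<Longrightarrow> h u < h w \<Longrightarrow> h w < h v \<Longrightarrow> \<not> in_shadow J a w (\<lambda>j. p j + t)"
    "\<And>w j. w \<in> W \<Longrightarrow> j \<in> J \<Longrightarrow> p j + t \<noteq> a w j \<and> p j + t \<noteq> a w j + 1"
    by (auto simp: trivial_limit_at_right_real)
  show ?thesis
  proof (rule that[OF t(1-3)])
    fix w assume "w \<in> W" "in_shadow J a w (\<lambda>j. p j + t)"
    then show "in_open_shadow J a w (\<lambda>j. p j + t)"
      using t(4)[of w] by (force simp: in_shadow_def in_open_shadow_def)
  qed
qed

text \<open>On a generic line each object sees the next one above it, with \<open>p\<close> itself
  as witness. The rest of the chain stays strictly above \<open>x\<close> and so never returns to
  it; this is what later contradicts the bridge property of the first edge.\<close>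

lemma sight_chain:
  assumes "finite V" "\<And>w. w \<in> V \<Longrightarrow> in_shadow J a w p \<Longrightarrow> in_open_shadow J a w p"
    and v: "v \<in> V" "in_shadow J a v p"
    and x: "x \<in> V" "in_shadow J a x p" "h x < h v"
  shows "\<exists>y. y \<in> V \<and> sees J a h V x y \<and> in_shadow J a y p \<and> (y = v \<or> h y < h v) \<and>
    (y, v) \<in> (Restr (sight_rel J a h V) {w. h x < h w})\<^sup>*"
  using x
proof (induction "card {w \<in> V. h x < h w \<and> h w < h v \<and> in_shadow J a w p}" arbitrary: x rule: less_induct)
  case less
  let ?B = "\<lambda>x. {w \<in> V. h x < h w \<and> h w < h v \<and> in_shadow J a w p}"
  have fin: "finite (?B x)" for x using \<open>finite V\<close> by simp
  have seesI: "sees J a h V x y"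
    if "y \<in> V" "in_shadow J a y p" "h x < h y" "\<And>w. w \<in> ?B x \<Longrightarrow> h y \<le> h w" "h y \<le> h v" for y
    using that less.prems assms(2) unfolding sees_def
    by (intro conjI exI[of _ p]) force+
  show ?case
  proof (cases "?B x = {}")
    case True
    then have "sees J a h V x v" using seesI[of v] v less.prems by auto
    then show ?thesis using v by blast
  next
    case False
    \<comment> \<open>A lowest object on the line above \<open>x\<close>. Objects at the same height
      as \<open>y\<close> do not block, since blocking requires a strictly intermediate
      height.\<close>
    define y where "y = arg_min_on h (?B x)"
    have y: "y \<in> ?B x" and min: "\<And>w. w \<in> ?B x \<Longrightarrow> h y \<le> h w"
      using arg_min_if_finite[OF fin False, of h] by (force simp: y_def not_less)+
    have "?B y \<subset> ?B x" using y by force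
    then have "card (?B y) < card (?B x)" using fin by (simp add: psubset_card_mono)
    then obtain z where z: "z \<in> V" "sees J a h V y z"
      "(z, v) \<in> (Restr (sight_rel J a h V) {w. h y < h w})\<^sup>*"
      using less.hyps[of y] y by blast
    have "h x < h y" using y by simp
    then have "(z, v) \<in> (Restr (sight_rel J a h V) {w. h x < h w})\<^sup>*"
      by (intro rtrancl_mono_in[OF z(3)]) auto
    moreover have "(y, z) \<in> Restr (sight_rel J a h V) {w. h x < h w}"
      using z(1,2) y by (auto simp: sight_rel_def sees_def)
    ultimately have "(y, v) \<in> (Restr (sight_rel J a h V) {w. h x < h w})\<^sup>*"
      by (rule converse_rtrancl_into_rtrancl[rotated])
    moreover have "sees J a h V x y" using seesI[OF _ _ _ min] y by auto
    ultimately show ?thesis using y by blast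
  qed
qed

text \<open>What can go wrong when the objects outside \<open>C\<close> are put back: the first
  object that a generic line meets above \<open>u\<close> is either \<open>v\<close> or such an
  outsider \<open>w\<close>, and from \<open>w\<close> the chain continues to \<open>v\<close>
  without returning to \<open>u\<close>.\<close>

lemma sees_subset_cases:
  assumes "finite J" "finite V" "C \<subseteq> V" "u \<in> V" "v \<in> V" and sees: "sees J a h C u v"
  obtains "sees J a h V u v"
  | w where "w \<in> V - C" "sees J a h V u w" "(w, v) \<in> (Restr (sight_rel J a h V) (- {u}))\<^sup>*"
proof -
  obtain p where p: "in_open_shadow J a u p" "in_open_shadow J a v p"
    "\<And>w. w \<in> C \<Longrightarrow> h u < h w \<Longrightarrow> h w < h v \<Longrightarrow> \<not> in_shadow J a w p"
    "\<And>w. w \<in> V \<Longrightarrow> in_shadow J a w p \<Longrightarrow> in_open_shadow J a w p"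
    using sees_generic[OF assms(1,2) finite_subset[OF assms(3,2)] sees] by blast
  have "h u < h v" using sees by (simp add: sees_def)
  then obtain w where w: "w \<in> V" "sees J a h V u w" "in_shadow J a w p" "w = v \<or> h w < h v"
    "(w, v) \<in> (Restr (sight_rel J a h V) {w. h u < h w})\<^sup>*"
    using sight_chain[OF assms(2) p(4) assms(5) in_open_shadow_imp[OF p(2)]
        assms(4) in_open_shadow_imp[OF p(1)]] by blast
  show ?thesis
  proof (cases "w = v")
    case True
    then show ?thesis using w that(1) by blast
  next
    case False
    have "h u < h w" using w(2) by (simp add: sees_def)
    then have "w \<notin> C" using False w p(3) by blast
    moreover have "(w, v) \<in> (Restr (sight_rel J a h V) (- {u}))\<^sup>*"
      by (rule rtrancl_mono_in[OF w(5)]) auto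
    ultimately show ?thesis using w that(2) by blast
  qed
qed

section \<open>Invariance of visibility under changes of the representation\<close>

lemma sees_translate_imp:
  assumes "u \<in> V" "v \<in> V" "sees J a h V u v"
    and shift: "\<And>w j. w \<in> V \<Longrightarrow> j \<in> J \<Longrightarrow> b w j = a w j + t j"
    and order: "\<And>x y. x \<in> V \<Longrightarrow> y \<in> V \<Longrightarrow> g x < g y \<longleftrightarrow> h x < h y"
  shows "sees J b g V u v"
proof -
  have "in_shadow J b w (\<lambda>j. p j + t j) = in_shadow J a w p"
    "in_open_shadow J b w (\<lambda>j. p j + t j) = in_open_shadow J a w p" if "w \<in> V" for w p
    using shift[OF that] by (auto simp: in_shadow_def in_open_shadow_def)
  note shadow = this
  obtain p where p: "in_open_shadow J a u p" "in_open_shadow J a v p"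
    "\<And>w. w \<in> V \<Longrightarrow> h u < h w \<Longrightarrow> h w < h v \<Longrightarrow> \<not> in_shadow J a w p"
    using assms(3) unfolding sees_def by blast
  have "g u < g v" using assms(1-3) order by (simp add: sees_def)
  then show ?thesis unfolding sees_def
    by (intro conjI exI[of _ "\<lambda>j. p j + t j"]) (use p shadow order assms(1,2) in auto)
qed

lemma sees_translate:
  assumes "u \<in> V" "v \<in> V"
    and "\<And>w j. w \<in> V \<Longrightarrow> j \<in> J \<Longrightarrow> b w j = a w j + t j"
    and "\<And>x y. x \<in> V \<Longrightarrow> y \<in> V \<Longrightarrow> g x < g y \<longleftrightarrow> h x < h y"
  shows "sees J b g V u v \<longleftrightarrow> sees J a h V u v"
  using sees_translate_imp[OF assms(1,2), of J a h b t g]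
    sees_translate_imp[OF assms(1,2), of J b g a "\<lambda>j. - t j" h] assms(3,4) by auto

lemma sees_permute:
  assumes "\<And>j. \<sigma> (\<sigma> j) = j"
  shows "sees J (\<lambda>w. a w \<circ> \<sigma>) h V u v \<longleftrightarrow> sees (\<sigma> ` J) a h V u v"
proof -
  have shadow: "in_shadow J (\<lambda>w. a w \<circ> \<sigma>) w (p \<circ> \<sigma>) = in_shadow (\<sigma> ` J) a w p"
    "in_open_shadow J (\<lambda>w. a w \<circ> \<sigma>) w (p \<circ> \<sigma>) = in_open_shadow (\<sigma> ` J) a w p" for w p
    by (auto simp: in_shadow_def in_open_shadow_def)
  have "(\<exists>p. P p) \<longleftrightarrow> (\<exists>p. P (p \<circ> \<sigma>))" for P :: "(nat \<Rightarrow> real) \<Rightarrow> bool"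
  proof
    assume "\<exists>p. P p"
    then obtain p where "P p" by blast
    moreover have "(p \<circ> \<sigma>) \<circ> \<sigma> = p" using assms by (simp add: fun_eq_iff)
    ultimately show "\<exists>p. P (p \<circ> \<sigma>)" by (intro exI[of _ "p \<circ> \<sigma>"]) simp
  qed blast
  from this[of "\<lambda>p. in_open_shadow J (\<lambda>w. a w \<circ> \<sigma>) u p \<and> in_open_shadow J (\<lambda>w. a w \<circ> \<sigma>) v p \<and>
      (\<forall>w\<in>V. h u < h w \<longrightarrow> h w < h v \<longrightarrow> \<not> in_shadow J (\<lambda>w. a w \<circ> \<sigma>) w p)"]
  show ?thesis unfolding sees_def shadow by simp
qed

text \<open>Only the heights of objects whose shadows share the line matter, and
  \<open>separated\<close> makes those heights different. Ties may therefore be broken in any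
  way.\<close>

lemma sees_refine_heights:
  assumes "separated J a h V" "u \<in> V" "v \<in> V"
    and order: "\<And>x y. x \<in> V \<Longrightarrow> y \<in> V \<Longrightarrow> h x < h y \<Longrightarrow> g x < g y"
  shows "sees J a g V u v \<longleftrightarrow> sees J a h V u v"
proof -
  have tie: "(h x < h y \<longleftrightarrow> g x < g y) \<and> (h y < h x \<longleftrightarrow> g y < g x)"
    if xy: "x \<in> V" "y \<in> V" and p: "in_open_shadow J a x p" "in_shadow J a y p" for x y p
  proof (cases "x = y")
    case False
    have "h x \<noteq> h y"
    proof
      assume "h x = h y"
      then obtain j where "j \<in> J" "1 < \<bar>a x j - a y j\<bar>"
        using assms(1) xy False unfolding separated_def by blast
      then show False using shadow_overlap[OF p] by force
    qed
    then consider "h x < h y" | "h y < h x" by linarith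
    then show ?thesis using order[OF xy] order[OF xy(2,1)] by cases auto
  qed simp
  have "h u < h v \<and> (\<forall>w\<in>V. h u < h w \<longrightarrow> h w < h v \<longrightarrow> \<not> in_shadow J a w p) \<longleftrightarrow>
    g u < g v \<and> (\<forall>w\<in>V. g u < g w \<longrightarrow> g w < g v \<longrightarrow> \<not> in_shadow J a w p)"
    if p: "in_open_shadow J a u p" "in_open_shadow J a v p" for p
    using tie[OF assms(2,3) p(1) in_open_shadow_imp[OF p(2)]]
      tie[OF assms(2) _ p(1)] tie[OF assms(3) _ p(2)] by blast
  then show ?thesis unfolding sees_def by blast
qed

text \<open>An object at transverse distance at least 1 from \<open>u\<close> covers no line through
  the open shadow of \<open>u\<close>. This isolates the classes from each other once they are
  placed together.\<close>

lemma sees_subset_iff: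
  assumes "C \<subseteq> V" "\<And>w. w \<in> V - C \<Longrightarrow> \<exists>j\<in>J. 1 \<le> \<bar>a u j - a w j\<bar>"
  shows "sees J a h V u v \<longleftrightarrow> sees J a h C u v"
proof -
  have "\<not> in_shadow J a w p" if "w \<in> V - C" "in_open_shadow J a u p" for w p
    using assms(2)[OF that(1)] shadow_overlap[OF that(2)] by force
  then show ?thesis using assms(1) unfolding sees_def by blast
qed

section \<open>From cubes to forests\<close>

lemma sight_rel_verts: "sight_rel J a h V \<subseteq> V \<times> V"
  by (auto simp: sight_rel_def)

lemma sight_rel_permute:
  assumes "\<And>j. \<sigma> (\<sigma> j) = j"
  shows "sight_rel J (\<lambda>w. a w \<circ> \<sigma>) h V = sight_rel (\<sigma> ` J) a h V"
  by (simp only: sight_rel_def sees_permute[of \<sigma> J a h V, OF assms])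

lemma separated_permute: "separated J (\<lambda>w. a w \<circ> \<sigma>) h V \<longleftrightarrow> separated (\<sigma> ` J) a h V"
  by (simp add: separated_def)

lemma separated_subset: "separated J a h V \<Longrightarrow> C \<subseteq> V \<Longrightarrow> separated J a h C"
  unfolding separated_def by blast

lemma flat_cuboids_disjoint_iff:
  assumes Q: "\<And>v. v \<in> V \<Longrightarrow> Q v = cuboid (Suc m) (\<lambda>j. if j = m then 0 else 1) (a v)"
  shows "disjoint_family_on Q V \<longleftrightarrow> separated {..<m} a (\<lambda>v. a v m) V"
proof -
  have "Q u \<inter> Q v = {} \<longleftrightarrow> (a u m = a v m \<longrightarrow> (\<exists>j\<in>{..<m}. 1 < \<bar>a u j - a v j\<bar>))"
    if "u \<in> V" "v \<in> V" for u v
  proof -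
    have "(\<exists>j<Suc m. (if j = m then 0 else 1) < \<bar>a u j - a v j\<bar>) \<longleftrightarrow>
        a u m \<noteq> a v m \<or> (\<exists>j<m. 1 < \<bar>a u j - a v j\<bar>)"
      by (auto simp: less_Suc_eq)
    then show ?thesis using that by (subst (1 2) Q) (auto simp: cuboid_disjoint_iff)
  qed
  then show ?thesis by (auto simp: disjoint_family_on_def separated_def)
qed

lemma irrefl_rel_eqI:
  assumes "irrefl R" "irrefl S" "R \<subseteq> V \<times> V" "S \<subseteq> V \<times> V"
    and "\<And>u v. u \<in> V \<Longrightarrow> v \<in> V \<Longrightarrow> u \<noteq> v \<Longrightarrow> (u, v) \<in> R \<longleftrightarrow> (u, v) \<in> S"
  shows "R = S"
proof (rule set_eqI)
  fix e :: "'a \<times> 'a"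
  obtain u v where [simp]: "e = (u, v)" by (cases e)
  show "e \<in> R \<longleftrightarrow> e \<in> S"
    using assms(5)[of u v] assms(1-4) by (cases "u = v") (auto simp: irrefl_def)
qed

lemma orthogonal_visibility_iff_last_axis:
  "cube_orthogonal_visibility_graph m H \<longleftrightarrow> pair_graph H \<and>
    (\<exists>a h. separated {..<m} a h (pverts H) \<and> parcs H = sight_rel {..<m} a h (pverts H))"
  (is "?L \<longleftrightarrow> ?R")
proof
  let ?s = "\<lambda>j. if j = m then 0 else 1 :: real"
  have axes: "{..<Suc m} - {m} = {..<m}" by auto
  {
    assume ?L
    then obtain Q where "pair_graph H" and Q: "\<forall>v\<in>pverts H. Q v \<in> flat_unit_cubes m"
      and disj: "disjoint_family_on Q (pverts H)"
      and vis: "\<forall>u\<in>pverts H. \<forall>v\<in>pverts H. u \<noteq> v \<longrightarrow>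
        ((u, v) \<in> parcs H \<longleftrightarrow> visible (Suc m) m (pverts H) Q u v)"
      unfolding cube_orthogonal_visibility_graph_def by (elim conjE exE) (rule that)
    have "\<exists>a. Q v = cuboid (Suc m) ?s a" if v: "v \<in> pverts H" for v
    proof -
      obtain a c where "Q v = {x \<in> points (Suc m). (\<forall>i<m. x i \<in> {a i..a i + 1}) \<and> x m = c}"
        using Q v by (auto simp: flat_unit_cubes_def)
      also have "\<dots> = cuboid (Suc m) ?s (a(m := c))"
        by (force simp: cuboid_def less_Suc_eq)
      finally show ?thesis by blast
    qed
    then obtain a where a: "\<And>v. v \<in> pverts H \<Longrightarrow> Q v = cuboid (Suc m) ?s (a v)" by metis
    have "(u, v) \<in> parcs H \<longleftrightarrow> (u, v) \<in> sight_rel {..<m} a (\<lambda>v. a v m) (pverts H)"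
      if "u \<in> pverts H" "v \<in> pverts H" "u \<noteq> v" for u v
      using visible_iff_sight_rel[of m "Suc m" ?s "pverts H" Q a u v] vis[rule_format, OF that] that a disj
        pair_graph_finite[OF \<open>pair_graph H\<close>] by (simp add: axes)
    moreover have "sight_rel {..<m} a (\<lambda>v. a v m) (pverts H) \<subseteq> pverts H \<times> pverts H"
      by (auto simp: sight_rel_def)
    ultimately have "parcs H = sight_rel {..<m} a (\<lambda>v. a v m) (pverts H)"
      using pair_graph_arcs[OF \<open>pair_graph H\<close>] pair_graph_irrefl[OF \<open>pair_graph H\<close>]
      by (intro irrefl_rel_eqI[of "parcs H" _ "pverts H"] irrefl_sight_rel)
    moreover have "separated {..<m} a (\<lambda>v. a v m) (pverts H)"
      using flat_cuboids_disjoint_iff[of "pverts H" Q m a] a disj by blast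
    ultimately show ?R using \<open>pair_graph H\<close> by blast
  next
    assume ?R
    then obtain a h where H: "pair_graph H" "separated {..<m} a h (pverts H)"
      "parcs H = sight_rel {..<m} a h (pverts H)" by blast
    \<comment> \<open>The height is stored in coordinate \<open>m\<close> of the corner, which
      shadows over \<open>{..<m}\<close> ignore.\<close>
    define b where "b v = (a v)(m := h v)" for v
    define Q where "Q v = cuboid (Suc m) ?s (b v)" for v
    have shadow: "in_shadow {..<m} b = in_shadow {..<m} a" "in_open_shadow {..<m} b = in_open_shadow {..<m} a"
      by (auto simp: in_shadow_def in_open_shadow_def b_def fun_eq_iff)
    have bm: "(\<lambda>v. b v m) = h" by (simp add: b_def)
    have "separated {..<m} b h (pverts H)" using H(2) by (simp add: separated_def b_def)
    then have disj: "disjoint_family_on Q (pverts H)"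
      using flat_cuboids_disjoint_iff[of "pverts H" Q m b] Q_def bm by simp
    have arcs: "parcs H = sight_rel {..<m} b (\<lambda>v. b v m) (pverts H)"
      using H(3) bm by (simp add: sight_rel_def sees_def shadow)
    have "Q v \<in> flat_unit_cubes m" for v
      unfolding flat_unit_cubes_def Q_def cuboid_def
      by (intro CollectI exI[of _ "b v"] exI[of _ "b v m"]) (force simp: less_Suc_eq)
    moreover have "(u, v) \<in> parcs H \<longleftrightarrow> visible (Suc m) m (pverts H) Q u v"
      if "u \<in> pverts H" "v \<in> pverts H" "u \<noteq> v" for u v
      using visible_iff_sight_rel[of m "Suc m" ?s "pverts H" Q b u v] that disj arcs Q_def
        pair_graph_finite[OF H(1)] by (simp add: axes)
    ultimately show ?L unfolding cube_orthogonal_visibility_graph_def using H(1) disj by blast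
  }
qed

text \<open>Swapping axis \<open>i\<close> with the last axis allows the forest of colour
  \<open>i\<close> to be viewed along axis \<open>i\<close> of the common space.\<close>

lemma orthogonal_visibility_iff:
  assumes "i < n"
  shows "cube_orthogonal_visibility_graph (n - 1) H \<longleftrightarrow> pair_graph H \<and>
    (\<exists>a h. separated ({..<n} - {i}) a h (pverts H) \<and>
           parcs H = sight_rel ({..<n} - {i}) a h (pverts H))"
proof -
  define \<sigma> where "\<sigma> j = (if j = i then n - 1 else if j = n - 1 then i else j)" for j
  have \<sigma>: "\<sigma> (\<sigma> j) = j" for j by (simp add: \<sigma>_def)
  have s1: "\<sigma> ` {..<n - 1} \<subseteq> {..<n} - {i}" and s2: "\<sigma> ` ({..<n} - {i}) \<subseteq> {..<n - 1}"
    using assms by (auto simp: \<sigma>_def)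
  have "\<sigma> ` \<sigma> ` A = A" for A by (simp add: image_image \<sigma>)
  then have "\<sigma> ` {..<n - 1} = {..<n} - {i}" "\<sigma> ` ({..<n} - {i}) = {..<n - 1}"
    using s1 s2 image_mono[OF s1, of \<sigma>] image_mono[OF s2, of \<sigma>] by auto
  then have perm: "sight_rel {..<n - 1} (\<lambda>w. a w \<circ> \<sigma>) h V = sight_rel ({..<n} - {i}) a h V"
    "separated {..<n - 1} (\<lambda>w. a w \<circ> \<sigma>) h V = separated ({..<n} - {i}) a h V"
    "sight_rel ({..<n} - {i}) (\<lambda>w. a w \<circ> \<sigma>) h V = sight_rel {..<n - 1} a h V"
    "separated ({..<n} - {i}) (\<lambda>w. a w \<circ> \<sigma>) h V = separated {..<n - 1} a h V"
    for a :: "'a \<Rightarrow> nat \<Rightarrow> real" and h V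
    by (simp_all add: sight_rel_permute[of \<sigma>, OF \<sigma>] separated_permute)
  have "(\<exists>a h. separated {..<n - 1} a h V \<and> E = sight_rel {..<n - 1} a h V) \<longleftrightarrow>
      (\<exists>a h. separated ({..<n} - {i}) a h V \<and> E = sight_rel ({..<n} - {i}) a h V)"
    (is "?A \<longleftrightarrow> ?B") for V :: "'a set" and E
  proof
    assume ?A
    then obtain a h where "separated {..<n - 1} a h V" "E = sight_rel {..<n - 1} a h V" by blast
    then show ?B by (intro exI[of _ "\<lambda>w. a w \<circ> \<sigma>"] exI[of _ h]) (simp only: perm simp_thms)
  next
    assume ?B
    then obtain a h where "separated ({..<n} - {i}) a h V" "E = sight_rel ({..<n} - {i}) a h V" by blast
    then show ?A by (intro exI[of _ "\<lambda>w. a w \<circ> \<sigma>"] exI[of _ h]) (simp only: perm simp_thms)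
  qed
  then show ?thesis unfolding orthogonal_visibility_iff_last_axis by blast
qed

lemma cube_visibility_iff:
  "cube_visibility_graph n G \<longleftrightarrow> pair_graph G \<and>
    (\<exists>a. (\<forall>u\<in>pverts G. \<forall>v\<in>pverts G. u \<noteq> v \<longrightarrow> (\<exists>j<n. 1 < \<bar>a u j - a v j\<bar>)) \<and>
         parcs G = (\<Union>i<n. sight_rel ({..<n} - {i}) a (\<lambda>v. a v i) (pverts G)))"
  (is "?L \<longleftrightarrow> ?R")
proof
  let ?S = "\<lambda>a i. sight_rel ({..<n} - {i}) a (\<lambda>v. a v i) (pverts G)"
  have disj_iff: "disjoint_family_on Q (pverts G) \<longleftrightarrow>
      (\<forall>u\<in>pverts G. \<forall>v\<in>pverts G. u \<noteq> v \<longrightarrow> (\<exists>j<n. 1 < \<bar>a u j - a v j\<bar>))"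
    if "\<And>v. v \<in> pverts G \<Longrightarrow> Q v = cuboid n (\<lambda>_. 1) (a v)" for Q a
    using that by (simp add: disjoint_family_on_def cuboid_disjoint_iff)
  {
    assume ?L
    then obtain Q where G: "pair_graph G" and Q: "\<forall>v\<in>pverts G. Q v \<in> unit_cubes n"
      and disj: "disjoint_family_on Q (pverts G)"
      and vis: "\<forall>u\<in>pverts G. \<forall>v\<in>pverts G. u \<noteq> v \<longrightarrow>
        ((u, v) \<in> parcs G \<longleftrightarrow> (\<exists>i<n. visible n i (pverts G) Q u v))"
      unfolding cube_visibility_graph_def by (elim conjE exE) (rule that)
    have "\<exists>a. Q v = cuboid n (\<lambda>_. 1) a" if v: "v \<in> pverts G" for v
      using Q v by (auto simp: unit_cubes_def cuboid_def)
    then obtain a where a: "\<And>v. v \<in> pverts G \<Longrightarrow> Q v = cuboid n (\<lambda>_. 1) (a v)" by metis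
    have "(u, v) \<in> parcs G \<longleftrightarrow> (u, v) \<in> (\<Union>i<n. ?S a i)"
      if "u \<in> pverts G" "v \<in> pverts G" "u \<noteq> v" for u v
      using visible_iff_sight_rel[of _ n "\<lambda>_. 1" "pverts G" Q a u v] vis[rule_format, OF that] that a disj
        pair_graph_finite[OF G] by auto
    moreover have "(\<Union>i<n. ?S a i) \<subseteq> pverts G \<times> pverts G" "irrefl (\<Union>i<n. ?S a i)"
      by (auto simp: sight_rel_def irrefl_def sees_def)
    ultimately have "parcs G = (\<Union>i<n. ?S a i)"
      using pair_graph_arcs[OF G] pair_graph_irrefl[OF G]
      by (intro irrefl_rel_eqI[of "parcs G" _ "pverts G"])
    moreover have "\<forall>u\<in>pverts G. \<forall>v\<in>pverts G. u \<noteq> v \<longrightarrow> (\<exists>j<n. 1 < \<bar>a u j - a v j\<bar>)"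
      using disj disj_iff[of Q a, OF a] by simp
    ultimately show ?R using G by blast
  next
    assume ?R
    then obtain a where G: "pair_graph G"
      "\<forall>u\<in>pverts G. \<forall>v\<in>pverts G. u \<noteq> v \<longrightarrow> (\<exists>j<n. 1 < \<bar>a u j - a v j\<bar>)"
      "parcs G = (\<Union>i<n. ?S a i)" by blast
    define Q where "Q v = cuboid n (\<lambda>_. 1) (a v)" for v
    have disj: "disjoint_family_on Q (pverts G)" using G(2) disj_iff[of Q a, OF Q_def] by simp
    have "Q v \<in> unit_cubes n" for v
      unfolding unit_cubes_def Q_def cuboid_def by blast
    moreover have "(u, v) \<in> parcs G \<longleftrightarrow> (\<exists>i<n. visible n i (pverts G) Q u v)"
      if "u \<in> pverts G" "v \<in> pverts G" "u \<noteq> v" for u v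
      using visible_iff_sight_rel[of _ n "\<lambda>_. 1" "pverts G" Q a u v] that disj Q_def G(3)
        pair_graph_finite[OF G(1)] by auto
    ultimately show ?L unfolding cube_visibility_graph_def using G(1) disj by blast
  }
qed

section \<open>Components of the visibilities along one axis\<close>

lemma sight_rel_subset:
  assumes "C \<subseteq> V"
  shows "Restr (sight_rel J a h V) C \<subseteq> sight_rel J a h C"
  using assms by (fastforce simp: sight_rel_def sees_def)

text \<open>If an outsider blocked a line that starts at \<open>u\<close>, then by
  \<open>sees_subset_cases\<close> some outsider would be seen by \<open>u\<close> and hence belong
  to the class of \<open>u\<close>.\<close>

lemma sight_rel_class:
  assumes "finite J" "finite V" and C: "C \<in> edge_class V (sight_rel J a h V) ` V"
  shows "sight_rel J a h C = Restr (sight_rel J a h V) C"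
proof
  have "C \<subseteq> V" using C by (auto simp: edge_class_def)
  have "sees J a h V u v" if "u \<in> C" "v \<in> C" "sees J a h C u v" for u v
  proof -
    have "u \<in> V" "v \<in> V" using that \<open>C \<subseteq> V\<close> by auto
    from assms(1,2) \<open>C \<subseteq> V\<close> this that(3) show ?thesis
    proof (cases rule: sees_subset_cases)
      case (2 w)
      then have "(u, w) \<in> sight_rel J a h V" using \<open>u \<in> V\<close> by (simp add: sight_rel_def)
      then have "w \<in> C"
        using edge_class_closed[OF _ C \<open>u \<in> C\<close>] by (auto simp: sight_rel_def)
      then show ?thesis using 2 by blast
    qed
  qed
  then show "sight_rel J a h C \<subseteq> Restr (sight_rel J a h V) C"
    using \<open>C \<subseteq> V\<close> by (auto simp: sight_rel_def)
  show "Restr (sight_rel J a h V) C \<subseteq> sight_rel J a h C"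
    by (rule sight_rel_subset[OF \<open>C \<subseteq> V\<close>])
qed

lemma subgraph_with_projI:
  assumes "pair_graph G" "pair_graph H" "pverts H \<subseteq> pverts G" "parcs H \<subseteq> parcs G"
  shows "subgraph (with_proj H) (with_proj G)"
  using assms by (auto simp: subgraph_def wf_digraph_wp_iff pair_graph_def pair_digraph_def pair_fin_digraph_def)

lemma cube_visibility_imp_forests:
  assumes "1 \<le> n" and T: "is_tree T" and "cube_visibility_graph n T"
  shows "\<exists>F :: nat \<Rightarrow> 'a pair_pre_digraph.
    (\<forall>i<n. subgraph (with_proj (F i)) (with_proj T) \<and>
           cube_orthogonal_visibility_forest (n - 1) (F i)) \<and>
    T = graph_Union (F ` {..<n})"
proof -
  let ?V = "pverts T"
  obtain a where G: "pair_graph T"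
    and far: "\<forall>u\<in>?V. \<forall>v\<in>?V. u \<noteq> v \<longrightarrow> (\<exists>j<n. 1 < \<bar>a u j - a v j\<bar>)"
    and arcs: "parcs T = (\<Union>i<n. sight_rel ({..<n} - {i}) a (\<lambda>v. a v i) ?V)"
    using assms(3) unfolding cube_visibility_iff by blast
  define S where "S i = sight_rel ({..<n} - {i}) a (\<lambda>v. a v i) ?V" for i
  \<comment> \<open>Each forest spans all vertices; those without a visibility along axis
    \<open>i\<close> become one-vertex trees.\<close>
  define F where "F i = \<lparr>pverts = ?V, parcs = S i\<rparr>" for i
  have fin: "finite ?V" by (rule pair_graph_finite[OF G])
  have S: "S i \<subseteq> ?V \<times> ?V" "sym (S i)" "irrefl (S i)" for i
    unfolding S_def by (rule sight_rel_verts sym_sight_rel irrefl_sight_rel)+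
  have graph_Restr: "pair_graph \<lparr>pverts = C, parcs = Restr (S i) C\<rparr>" if "C \<subseteq> ?V" for C i
    using S[of i] that finite_subset[OF that fin]
    by (intro pair_graphI) (auto simp: sym_def irrefl_def)
  have forest: "cube_orthogonal_visibility_forest (n - 1) (F i)" if "i < n" for i
  proof -
    define X where "X = edge_class ?V (S i) ` ?V"
    define comp where "comp C = \<lparr>pverts = C, parcs = Restr (S i) C\<rparr>" for C
    have sub: "C \<subseteq> ?V" if "C \<in> X" for C using that by (auto simp: X_def edge_class_def)
    have "is_tree (comp C)" if C: "C \<in> X" for C
    proof (rule is_tree_subgraph[OF T])
      show "pair_graph (comp C)" "pverts (comp C) \<subseteq> ?V"
        using graph_Restr sub C by (simp_all add: comp_def)
      show "parcs (comp C) \<subseteq> parcs T"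
        using \<open>i < n\<close> by (auto simp: comp_def arcs S_def)
      show "pverts (comp C) \<noteq> {}"
        using C edge_class_self by (fastforce simp: X_def comp_def)
      show "(u, v) \<in> (parcs (comp C))\<^sup>*" if "u \<in> pverts (comp C)" "v \<in> pverts (comp C)" for u v
        using edge_class_connected[OF S(2,1), of C] C that by (simp add: comp_def X_def)
    qed
    moreover have "cube_orthogonal_visibility_graph (n - 1) (comp C)" if C: "C \<in> X" for C
    proof -
      have "separated ({..<n} - {i}) a (\<lambda>v. a v i) ?V"
        unfolding separated_def
      proof (intro ballI impI)
        fix u v assume "u \<in> ?V" "v \<in> ?V" "u \<noteq> v" and tie: "a u i = a v i"
        then obtain j where "j < n" "1 < \<bar>a u j - a v j\<bar>" using far by blast
        with tie show "\<exists>j\<in>{..<n} - {i}. 1 < \<bar>a u j - a v j\<bar>" by (intro bexI[of _ j]) auto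
      qed
      then have "separated ({..<n} - {i}) a (\<lambda>v. a v i) C" using sub[OF C] by (rule separated_subset)
      moreover have "Restr (S i) C = sight_rel ({..<n} - {i}) a (\<lambda>v. a v i) C"
        using sight_rel_class[of "{..<n} - {i}" ?V C] fin C by (simp add: X_def S_def)
      ultimately show ?thesis
        unfolding orthogonal_visibility_iff[OF \<open>i < n\<close>] using graph_Restr[OF sub[OF C], of i]
        by (auto simp: comp_def)
    qed
    moreover have "disjoint_family_on pverts (comp ` X)"
      unfolding disjoint_family_on_def
    proof (intro ballI impI)
      fix H H' assume "H \<in> comp ` X" "H' \<in> comp ` X" "H \<noteq> H'"
      then obtain C D where "C \<in> X" "D \<in> X" "H = comp C" "H' = comp D" "C \<noteq> D" by blast
      then show "pverts H \<inter> pverts H' = {}"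
        using edge_class_disjoint[OF S(2)[of i], of C ?V D] by (auto simp: comp_def X_def)
    qed
    moreover have "F i = graph_Union (comp ` X)"
    proof -
      have "?V = (\<Union>C\<in>X. C)" using edge_class_self sub by (fastforce simp: X_def)
      moreover have "S i \<subseteq> (\<Union>C\<in>X. Restr (S i) C)"
      proof clarify
        fix u v assume uv: "(u, v) \<in> S i"
        then have "u \<in> ?V" "edge_class ?V (S i) u \<in> X" using S(1) by (auto simp: X_def)
        then show "(u, v) \<in> (\<Union>C\<in>X. Restr (S i) C)"
          using uv edge_class_self[of u ?V "S i"]
            edge_class_closed[OF S(1)[of i], of "edge_class ?V (S i) u" u v]
          by (auto simp: X_def)
      qed
      ultimately show ?thesis by (auto simp: F_def graph_Union_def comp_def)
    qed
    moreover have "pair_graph (F i)"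
      unfolding F_def by (rule pair_graphI) (use fin S in auto)
    ultimately show ?thesis
      unfolding cube_orthogonal_visibility_forest_def by (intro conjI exI[of _ "comp ` X"]) auto
  qed
  have "subgraph (with_proj (F i)) (with_proj T)" if "i < n" for i
    using that fin S arcs G
    by (intro subgraph_with_projI) (auto simp: F_def S_def intro!: pair_graphI)
  moreover have "T = graph_Union (F ` {..<n})"
    using arcs \<open>1 \<le> n\<close>
    by (intro pair_pre_digraph.equality) (auto simp: graph_Union_def F_def S_def lessThan_empty_iff)
  ultimately show ?thesis using forest by blast
qed

section \<open>From forests to cubes\<close>

lemma injective_refinement:
  fixes h :: "'a \<Rightarrow> real"
  assumes "finite V"
  shows "\<exists>g :: 'a \<Rightarrow> real. inj_on g V \<and> (\<forall>x\<in>V. \<forall>y\<in>V. h x < h y \<longrightarrow> g x < g y)"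
proof -
  obtain f :: "'a \<Rightarrow> nat" where f: "inj_on f V"
    using finite_imp_inj_to_nat_seg[OF assms] by blast
  \<comment> \<open>The perturbation \<open>\<epsilon> * f\<close> must raise \<open>x\<close> by
    less than every gap above \<open>h x\<close>. The summand 1 keeps the divisor positive where
    \<open>f\<close> is 0.\<close>
  have "\<forall>\<^sub>F \<epsilon> in at_right 0. \<forall>e\<in>{e \<in> V \<times> V. h (fst e) < h (snd e)}.
      \<epsilon> < (h (snd e) - h (fst e)) / (real (f (fst e)) + 1)"
    by (intro eventually_ball_finite ballI eventually_at_right_0_less) (use assms in auto)
  from eventually_happens[OF eventually_conj[OF this eventually_at_right_less]]
  obtain \<epsilon> where \<epsilon>: "0 < \<epsilon>"
    "\<forall>e\<in>{e \<in> V \<times> V. h (fst e) < h (snd e)}. \<epsilon> < (h (snd e) - h (fst e)) / (real (f (fst e)) + 1)"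
    by (auto simp: trivial_limit_at_right_real)
  define g where "g x = h x + \<epsilon> * real (f x)" for x
  have mono: "g x < g y" if "x \<in> V" "y \<in> V" "h x < h y" for x y
  proof -
    have "\<epsilon> < (h y - h x) / (real (f x) + 1)" using \<epsilon>(2) that by auto
    then have "\<epsilon> * (real (f x) + 1) < h y - h x" by (simp add: pos_less_divide_eq)
    then have "\<epsilon> * real (f x) < h y - h x" using \<epsilon>(1) by (simp add: distrib_left)
    moreover have "0 \<le> \<epsilon> * real (f y)" using \<epsilon>(1) by simp
    ultimately show ?thesis by (simp add: g_def)
  qed
  have "inj_on g V"
  proof (rule inj_onI)
    fix x y assume xy: "x \<in> V" "y \<in> V" "g x = g y"
    then have "h x = h y" using mono[of x y] mono[of y x] by (metis less_irrefl linorder_neqE)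
    then have "f x = f y" using xy(3) \<epsilon>(1) by (simp add: g_def)
    then show "x = y" using f xy by (auto dest: inj_onD)
  qed
  then show ?thesis using mono by blast
qed

text \<open>
  Generic positive multipliers: each new one only has to avoid the finitely many values that make
  one of the finitely many sums vanish.
\<close>

lemma nonvanishing_combination:
  fixes d :: "'k \<Rightarrow> 'p \<Rightarrow> real"
  assumes "finite K" "finite P"
  shows "\<exists>c. (\<forall>k. 0 < c k) \<and>
    (\<forall>p\<in>P. (\<exists>k\<in>K. d k p \<noteq> 0) \<longrightarrow> (\<Sum>k\<in>K. c k * d k p) \<noteq> 0)"
  using assms(1)
proof (induction K rule: finite_induct)
  case empty
  then show ?case by (intro exI[of _ "\<lambda>_. 1"]) simp
next
  case (insert k0 K)
  then obtain c where c: "\<forall>k. 0 < c k"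
    "\<forall>p\<in>P. (\<exists>k\<in>K. d k p \<noteq> 0) \<longrightarrow> (\<Sum>k\<in>K. c k * d k p) \<noteq> 0" by blast
  \<comment> \<open>Where \<open>d k0 p = 0\<close> the quotient is 0 and excludes no positive
    value; for these \<open>p\<close> the old sum is already nonzero.\<close>
  have "infinite ({0<..} - (\<lambda>p. - (\<Sum>k\<in>K. c k * d k p) / d k0 p) ` P)"
    using assms(2) infinite_Ioi[of "0::real"] by (intro Diff_infinite_finite) auto
  from infinite_imp_nonempty[OF this]
  obtain t where "t \<in> {0<..} - (\<lambda>p. - (\<Sum>k\<in>K. c k * d k p) / d k0 p) ` P" by blast
  then have t: "0 < t" "\<And>p. p \<in> P \<Longrightarrow> t \<noteq> - (\<Sum>k\<in>K. c k * d k p) / d k0 p" by auto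
  have sum: "(\<Sum>k\<in>insert k0 K. (c(k0 := t)) k * d k p) = t * d k0 p + (\<Sum>k\<in>K. c k * d k p)" for p
  proof -
    have "(\<Sum>k\<in>K. (c(k0 := t)) k * d k p) = (\<Sum>k\<in>K. c k * d k p)"
      using insert.hyps by (intro sum.cong) auto
    then show ?thesis using insert.hyps by simp
  qed
  have "t * d k0 p + (\<Sum>k\<in>K. c k * d k p) \<noteq> 0"
    if "p \<in> P" "\<exists>k\<in>insert k0 K. d k p \<noteq> 0" for p
  proof (cases "d k0 p = 0")
    case True
    then show ?thesis using c(2) that by auto
  next
    case False
    then show ?thesis using t(2)[OF that(1)] by (auto simp: field_simps eq_neg_iff_add_eq_0)
  qed
  then show ?case using c(1) t(1) by (intro exI[of _ "c(k0 := t)"]) (simp only: sum, auto)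
qed

lemma dominating_multiplier:
  fixes f r :: "'p \<Rightarrow> real"
  assumes "finite P"
  shows "\<forall>\<^sub>F M in at_top. \<forall>p\<in>P. f p \<noteq> 0 \<longrightarrow> 1 < \<bar>M * f p + r p\<bar>"
proof (intro eventually_ball_finite ballI assms)
  fix p
  show "\<forall>\<^sub>F M in at_top. f p \<noteq> 0 \<longrightarrow> 1 < \<bar>M * f p + r p\<bar>"
  proof (cases "f p = 0")
    case False
    show ?thesis
      using eventually_gt_at_top[of "(1 + \<bar>r p\<bar>) / \<bar>f p\<bar>"] eventually_gt_at_top[of 0]
    proof eventually_elim
      case (elim M)
      then have "1 + \<bar>r p\<bar> < \<bar>M * f p\<bar>"
        using False by (simp add: pos_divide_less_eq abs_mult)
      then show ?case by linarith
    qed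
  qed simp
qed

section \<open>Gates and positions in an edge-coloured tree\<close>

locale edge_partition =
  fixes V :: "'a set" and E :: "'a rel" and n :: nat and R :: "nat \<Rightarrow> 'a rel"
  assumes finite_V: "finite V" and E_verts: "E \<subseteq> V \<times> V" and sym_E: "sym E"
    and bridges: "all_bridges E"
    and conn: "\<And>u v. u \<in> V \<Longrightarrow> v \<in> V \<Longrightarrow> (u, v) \<in> E\<^sup>*"
    and sym_R: "\<And>i. i < n \<Longrightarrow> sym (R i)"
    and E_eq: "E = (\<Union>i<n. R i)"
    and R_disjoint: "\<And>i k. i < n \<Longrightarrow> k < n \<Longrightarrow> i \<noteq> k \<Longrightarrow> R i \<inter> R k = {}"
begin

definition classes :: "nat \<Rightarrow> 'a set set" where
  "classes i = edge_class V (R i) ` V"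

text \<open>Deleting the edges of colour \<open>i\<close> inside a class \<open>C\<close> leaves
  components each of which contains exactly one vertex of \<open>C\<close>, the common gate of its
  vertices.\<close>

abbreviation E_outside :: "nat \<Rightarrow> 'a set \<Rightarrow> 'a rel" where
  "E_outside i C \<equiv> E - Restr (R i) C"

text \<open>The vertex at which the tree is entered from \<open>u\<close> when walking towards the class \<open>C\<close>.\<close>

definition gate :: "nat \<Rightarrow> 'a set \<Rightarrow> 'a \<Rightarrow> 'a" where
  "gate i C u = (SOME x. x \<in> C \<and> (u, x) \<in> (E_outside i C)\<^sup>*)"

lemma R_sub: "i < n \<Longrightarrow> R i \<subseteq> E"
  using E_eq by blast

lemma R_verts: "i < n \<Longrightarrow> R i \<subseteq> V \<times> V"
  using R_sub E_verts by blast

lemma finite_classes: "finite (classes i)"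
  by (simp add: classes_def finite_V)

lemma class_verts: "C \<in> classes i \<Longrightarrow> C \<subseteq> V"
  by (auto simp: classes_def edge_class_def)

lemma class_connected:
  assumes "i < n" "C \<in> classes i" "x \<in> C" "y \<in> C"
  shows "(x, y) \<in> (Restr (R i) C)\<^sup>*"
  using edge_class_connected[OF sym_R[OF assms(1)] R_verts[OF assms(1)]] assms
  by (simp add: classes_def)

lemma class_closed:
  assumes "i < n" "C \<in> classes i" "x \<in> C" "(x, y) \<in> (R i)\<^sup>*"
  shows "y \<in> C"
  using rtrancl_restrict_closed[OF assms(4,3)] edge_class_closed[OF R_verts[OF assms(1)]] assms(2)
  unfolding classes_def by blast

lemma class_of:
  assumes "i < n" "u \<in> V"
  obtains C where "C \<in> classes i" "u \<in> C"
  using assms edge_class_self[of u V "R i"] by (auto simp: classes_def)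

lemma sym_Restr: "i < n \<Longrightarrow> sym (Restr (R i) C)"
  using sym_R[of i] by (auto simp: sym_def)

lemma sym_outside: "i < n \<Longrightarrow> sym (E_outside i C)"
  using sym_Restr[of i C] sym_E by (auto simp: sym_def)

text \<open>A walk into \<open>C\<close>, cut off at its first vertex in \<open>C\<close>, uses no
  edge inside \<open>C\<close>.\<close>

lemma gate_props:
  assumes "i < n" "C \<in> classes i" "u \<in> V"
  shows "gate i C u \<in> C" and "(u, gate i C u) \<in> (E_outside i C)\<^sup>*"
proof -
  obtain c where "c \<in> C" using assms(2) edge_class_self by (fastforce simp: classes_def)
  then have "(u, c) \<in> E\<^sup>*" using conn assms(3) class_verts[OF assms(2)] by blast
  then have "\<exists>x. x \<in> C \<and> (u, x) \<in> (E_outside i C)\<^sup>*"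
  proof (induction rule: converse_rtrancl_induct)
    case base
    then show ?case using \<open>c \<in> C\<close> by blast
  next
    case (step u v)
    then show ?case by (cases "u \<in> C") (blast intro: converse_rtrancl_into_rtrancl)+
  qed
  from someI_ex[OF this] show "gate i C u \<in> C" "(u, gate i C u) \<in> (E_outside i C)\<^sup>*"
    unfolding gate_def by blast+
qed

text \<open>A vertex of \<open>C\<close> and its gate are joined both by edges inside
  \<open>C\<close> and by the remaining edges, which among bridges is possible only if they
  coincide.\<close>

lemma gate_self:
  assumes "i < n" "C \<in> classes i" "u \<in> C"
  shows "gate i C u = u"
proof -
  have "u \<in> V" using class_verts assms by blast
  note gate = gate_props[OF assms(1,2) this]
  have "Restr (R i) C \<subseteq> E" using R_sub[OF assms(1)] by blast
  from disconnected_outside_subrelation[OF bridges sym_E sym_Restr[OF assms(1)] this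
      class_connected[OF assms gate(1)] gate(2)]
  show ?thesis by simp
qed

lemma gate_eqI:
  assumes "i < n" "(u, w) \<in> (E_outside i C)\<^sup>*"
  shows "gate i C u = gate i C w"
proof -
  have "(u, x) \<in> (E_outside i C)\<^sup>* \<longleftrightarrow> (w, x) \<in> (E_outside i C)\<^sup>*" for x
    using assms(2) rtrancl_symD[OF sym_outside[OF assms(1)] assms(2)] by (meson rtrancl_trans)
  then show ?thesis by (simp add: gate_def)
qed

lemma gate_eqD:
  assumes "i < n" "C \<in> classes i" "u \<in> V" "w \<in> V" "gate i C u = gate i C w"
  shows "(u, w) \<in> (E_outside i C)\<^sup>*"
  using gate_props(2)[OF assms(1-3)] gate_props(2)[OF assms(1,2,4)] assms(5)
    rtrancl_symD[OF sym_outside[OF assms(1)]] by (metis rtrancl_trans)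

text \<open>Walking inside \<open>C\<close> uses no edge of \<open>D\<close>: different colours have
  disjoint edge sets, and different classes of one colour have disjoint vertex sets.\<close>

lemma gate_other_class:
  assumes "i < n" "C \<in> classes i" "u \<in> C" "w \<in> C"
    and "k < n" "D \<in> classes k" "k \<noteq> i \<or> D \<noteq> C"
  shows "gate k D u = gate k D w"
proof (rule gate_eqI[OF assms(5)], rule rtrancl_mono_in[OF class_connected[OF assms(1-4)]])
  have "Restr (R i) C \<inter> Restr (R k) D = {}"
  proof (cases "k = i")
    case True
    then have "C \<inter> D = {}"
      using edge_class_disjoint[OF sym_R[OF assms(1)]] assms(2,6,7) unfolding classes_def by blast
    then show ?thesis by blast
  next
    case False
    then show ?thesis using R_disjoint[of i k] assms by blast
  qed
  then show "Restr (R i) C \<subseteq> E_outside k D" using R_sub[OF assms(1)] by blast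
qed

text \<open>If all gates in classes of the other colours agreed, no edge outside \<open>R i\<close>
  would separate \<open>u\<close> from \<open>w\<close>, and \<open>connected_in_subrelation\<close>
  would join them within \<open>R i\<close>.\<close>

lemma gate_separates:
  assumes "i < n" "u \<in> V" "w \<in> V" "(u, w) \<notin> (R i)\<^sup>*"
  obtains k D where "k < n" "k \<noteq> i" "D \<in> classes k" "gate k D u \<noteq> gate k D w"
proof (rule ccontr)
  assume "\<not> thesis"
  then have eq: "gate k D u = gate k D w" if "k < n" "k \<noteq> i" "D \<in> classes k" for k D
    using that \<open>\<And>k D. \<lbrakk>k < n; k \<noteq> i; D \<in> classes k; gate k D u \<noteq> gate k D w\<rbrakk> \<Longrightarrow> thesis\<close> by blast
  have "(u, w) \<in> (R i)\<^sup>*"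
  proof (rule connected_in_subrelation[OF bridges sym_E sym_R R_sub conn])
    fix s t assume st: "(s, t) \<in> E - R i"
    then obtain k where k: "k < n" "k \<noteq> i" "(s, t) \<in> R k" using E_eq by blast
    then have "s \<in> V" using R_verts by blast
    define D where "D = edge_class V (R k) s"
    have D: "D \<in> classes k" "s \<in> D"
      using \<open>s \<in> V\<close> edge_class_self by (auto simp: D_def classes_def)
    then have "t \<in> D" using class_closed[OF k(1)] k(3) by blast
    then have "(s, t) \<in> Restr (R k) D" "(t, s) \<in> Restr (R k) D"
      using D k(3) sym_R[OF k(1)] by (auto dest: symD)
    moreover have "(u, w) \<in> (E_outside k D)\<^sup>*"
      using gate_eqD[OF k(1) D(1) assms(2,3) eq[OF k(1,2) D(1)]] .
    ultimately show "(u, w) \<in> (without_edge E s t)\<^sup>*"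
      by (elim rtrancl_mono_in) auto
  qed (use assms in auto)
  then show False using assms(4) by blast
qed

text \<open>
  A vertex is placed at the sum, over all classes, of the positions of its gates. In the
  coordinate \<open>c\<close> the classes of colour \<open>c\<close> contribute very large and generic heights, and all other
  classes contribute bounded amounts. So two vertices with different gates in some class of
  colour \<open>c\<close> are far apart in that coordinate.
\<close>

lemma cube_positions:
  fixes a :: "nat \<Rightarrow> 'a set \<Rightarrow> 'a \<Rightarrow> nat \<Rightarrow> real" and g :: "nat \<Rightarrow> 'a set \<Rightarrow> 'a \<Rightarrow> real"
  assumes "0 < n"
    and inj: "\<And>i C. i < n \<Longrightarrow> C \<in> classes i \<Longrightarrow> inj_on (g i C) C"
    and rep: "\<And>i C. i < n \<Longrightarrow> C \<in> classes i \<Longrightarrow>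
      sight_rel ({..<n} - {i}) (a i C) (g i C) C = Restr (R i) C"
  obtains pos where
    "\<forall>u\<in>V. \<forall>v\<in>V. u \<noteq> v \<longrightarrow> (\<exists>j<n. 1 < \<bar>pos u j - pos v j\<bar>)"
    "\<forall>i<n. sight_rel ({..<n} - {i}) pos (\<lambda>v. pos v i) V = R i"
proof -
  define d where "d c C p = g c C (gate c C (fst p)) - g c C (gate c C (snd p))" for c C p
  have "\<exists>l. (\<forall>C. 0 < l C) \<and> (\<forall>p\<in>V \<times> V. (\<exists>C\<in>classes c. d c C p \<noteq> 0) \<longrightarrow>
      (\<Sum>C\<in>classes c. l C * d c C p) \<noteq> 0)" for c
    by (rule nonvanishing_combination) (simp_all add: finite_classes finite_V)
  from choice[OF allI[OF this]]
  obtain l where "\<forall>c. (\<forall>C. 0 < l c C) \<and> (\<forall>p\<in>V \<times> V. (\<exists>C\<in>classes c. d c C p \<noteq> 0) \<longrightarrow>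
      (\<Sum>C\<in>classes c. l c C * d c C p) \<noteq> 0)" ..
  then have l: "\<And>c C. 0 < l c C"
    "\<And>c p. p \<in> V \<times> V \<Longrightarrow> \<exists>C\<in>classes c. d c C p \<noteq> 0 \<Longrightarrow> (\<Sum>C\<in>classes c. l c C * d c C p) \<noteq> 0"
    by blast+
  \<comment> \<open>Coordinate \<open>c\<close> splits into the weighted heights \<open>f\<close>
    from the classes of colour \<open>c\<close> and the transverse positions \<open>r\<close> from
    all other classes.\<close>
  define f where "f c u = (\<Sum>C\<in>classes c. l c C * g c C (gate c C u))" for c u
  define r where "r c u = (\<Sum>k\<in>{..<n} - {c}. \<Sum>C\<in>classes k. a k C (gate k C u) c)" for c u
  have f_diff: "f c u - f c w = (\<Sum>C\<in>classes c. l c C * d c C (u, w))" for c u w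
    by (simp add: f_def d_def sum_subtractf right_diff_distrib)
  \<comment> \<open>The colour is part of the index so that a single \<open>M\<close> serves all
    coordinates.\<close>
  have "\<forall>\<^sub>F M in at_top. \<forall>p\<in>{..<n} \<times> V \<times> V.
      (case p of (c, u, w) \<Rightarrow> f c u - f c w) \<noteq> 0 \<longrightarrow>
      1 < \<bar>M * (case p of (c, u, w) \<Rightarrow> f c u - f c w) + (case p of (c, u, w) \<Rightarrow> r c u - r c w)\<bar>"
    by (rule dominating_multiplier) (simp add: finite_V)
  from eventually_happens[OF eventually_conj[OF this eventually_gt_at_top[of 0]]]
  obtain M where "0 < M" and "\<forall>p\<in>{..<n} \<times> V \<times> V.
      (case p of (c, u, w) \<Rightarrow> f c u - f c w) \<noteq> 0 \<longrightarrow>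
      1 < \<bar>M * (case p of (c, u, w) \<Rightarrow> f c u - f c w) + (case p of (c, u, w) \<Rightarrow> r c u - r c w)\<bar>"
    using that by auto
  then have M: "1 < \<bar>M * (f c u - f c w) + (r c u - r c w)\<bar>"
    if "c < n" "u \<in> V" "w \<in> V" "f c u - f c w \<noteq> 0" for c u w
    using bspec[of "{..<n} \<times> V \<times> V" _ "(c, u, w)"] that by fastforce
  define pos where "pos u c = M * f c u + r c u" for u c
  have pos_diff: "pos u c - pos w c = M * (f c u - f c w) + (r c u - r c w)" for u w c
    by (simp add: pos_def right_diff_distrib)
  have far: "1 < \<bar>pos u c - pos w c\<bar>"
    if "c < n" "C \<in> classes c" "u \<in> V" "w \<in> V" "gate c C u \<noteq> gate c C w" for c C u w
  proof -
    have "d c C (u, w) \<noteq> 0"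
      using inj_onD[OF inj[OF that(1,2)], of "gate c C u" "gate c C w"]
        gate_props(1)[OF that(1,2)] that(3-5) by (auto simp: d_def)
    then have "f c u - f c w \<noteq> 0" using l(2)[of "(u, w)" c] that by (auto simp: f_diff)
    then show ?thesis using M[OF that(1,3,4)] by (simp add: pos_diff)
  qed
  have separate: "\<exists>j\<in>{..<n} - {i}. 1 < \<bar>pos u j - pos w j\<bar>"
    if iuw: "i < n" "u \<in> V" "w \<in> V" "(u, w) \<notin> (R i)\<^sup>*" for i u w
  proof -
    obtain k D where "k < n" "k \<noteq> i" "D \<in> classes k" "gate k D u \<noteq> gate k D w"
      using gate_separates[OF iuw] .
    then show ?thesis using far[of k D u w] iuw(2,3) by (intro bexI[of _ k]) auto
  qed
  \<comment> \<open>By \<open>gate_other_class\<close> only the summand of \<open>C\<close> itself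
    can change between \<open>u\<close> and \<open>w\<close>, and their gates in \<open>C\<close>
    are \<open>u\<close> and \<open>w\<close>.\<close>
  have in_class: "pos u i - pos w i = M * l i C * (g i C u - g i C w)"
      "\<And>j. j \<in> {..<n} - {i} \<Longrightarrow> pos u j - pos w j = a i C u j - a i C w j"
    if i: "i < n" and C: "C \<in> classes i" and uw: "u \<in> C" "w \<in> C" for i C u w
  proof -
    note other = gate_other_class[OF i C uw]
    note self = gate_self[OF i C uw(1)] gate_self[OF i C uw(2)]
    have zero: "d k D (u, w) = 0" if "k < n" "D \<in> classes k" "k \<noteq> i \<or> D \<noteq> C" for k D
      using other[OF that] by (simp add: d_def)
    have "f i u - f i w = l i C * d i C (u, w) + (\<Sum>D\<in>classes i - {C}. l i D * d i D (u, w))"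
      unfolding f_diff by (rule sum.remove[OF finite_classes C])
    also have "\<dots> = l i C * (g i C u - g i C w)"
      using zero i self by (simp add: d_def)
    finally have "f i u - f i w = l i C * (g i C u - g i C w)" .
    moreover have "r i u = r i w"
      unfolding r_def using other by (intro sum.cong refl) auto
    ultimately show "pos u i - pos w i = M * l i C * (g i C u - g i C w)"
      by (simp add: pos_diff)
    fix j assume j: "j \<in> {..<n} - {i}"
    then have "f j u - f j w = 0" unfolding f_diff using zero by (intro sum.neutral) auto
    let ?T = "\<lambda>k D. a k D (gate k D u) j - a k D (gate k D w) j"
    have "r j u - r j w = (\<Sum>k\<in>{..<n} - {j}. \<Sum>D\<in>classes k. ?T k D)"
      by (simp add: r_def sum_subtractf)
    also have "\<dots> = (\<Sum>D\<in>classes i. ?T i D) + (\<Sum>k\<in>{..<n} - {j} - {i}. \<Sum>D\<in>classes k. ?T k D)"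
      using i j by (intro sum.remove) auto
    also have "(\<Sum>k\<in>{..<n} - {j} - {i}. \<Sum>D\<in>classes k. ?T k D) = 0"
      using other by (intro sum.neutral ballI) auto
    also have "(\<Sum>D\<in>classes i. ?T i D) = ?T i C + (\<Sum>D\<in>classes i - {C}. ?T i D)"
      by (rule sum.remove[OF finite_classes C])
    also have "(\<Sum>D\<in>classes i - {C}. ?T i D) = 0"
      using other i by (intro sum.neutral ballI) auto
    finally show "pos u j - pos w j = a i C u j - a i C w j"
      using \<open>f j u - f j w = 0\<close> self by (simp add: pos_diff)
  qed
  show ?thesis
  proof (rule that[of pos])
    show "\<forall>u\<in>V. \<forall>v\<in>V. u \<noteq> v \<longrightarrow> (\<exists>j<n. 1 < \<bar>pos u j - pos v j\<bar>)"
    proof (intro ballI impI)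
      fix u v assume uv: "u \<in> V" "v \<in> V" "u \<noteq> v"
      \<comment> \<open>Colour 0 stands for any colour: either both vertices share a class of this
        colour and are their own, different gates there, or they differ in a gate of another
        colour.\<close>
      obtain C where C: "C \<in> classes 0" "u \<in> C" using class_of[OF \<open>0 < n\<close> uv(1)] .
      show "\<exists>j<n. 1 < \<bar>pos u j - pos v j\<bar>"
      proof (cases "(u, v) \<in> (R 0)\<^sup>*")
        case True
        then have "v \<in> C" using class_closed[OF \<open>0 < n\<close> C] by blast
        then have "gate 0 C u \<noteq> gate 0 C v" using gate_self[OF \<open>0 < n\<close> C(1)] C(2) uv(3) by simp
        then show ?thesis using far[OF \<open>0 < n\<close> C(1) uv(1,2)] \<open>0 < n\<close> by blast
      next
        case False
        then show ?thesis using separate[OF \<open>0 < n\<close> uv(1,2)] by blast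
      qed
    qed
    have "sight_rel ({..<n} - {i}) pos (\<lambda>v. pos v i) V = R i" if i: "i < n" for i
    proof -
      let ?J = "{..<n} - {i}"
      have within: "(u, v) \<in> sight_rel ?J pos (\<lambda>v. pos v i) V \<longleftrightarrow> (u, v) \<in> R i"
        if C: "C \<in> classes i" and uv: "u \<in> C" "v \<in> C" for C u v
      proof -
        have sees: "sees ?J pos (\<lambda>v. pos v i) V x y \<longleftrightarrow> sees ?J (a i C) (g i C) C x y"
          if xy: "x \<in> C" "y \<in> C" for x y
        proof -
          have "\<exists>j\<in>?J. 1 \<le> \<bar>pos x j - pos w j\<bar>" if w: "w \<in> V - C" for w
          proof -
            have "x \<in> V" "w \<in> V" "(x, w) \<notin> (R i)\<^sup>*"
              using class_closed[OF i C xy(1), of w] class_verts[OF C] xy(1) w by auto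
            from separate[OF i this] obtain j where "j \<in> ?J" "1 < \<bar>pos x j - pos w j\<bar>" by blast
            then show ?thesis by (intro bexI[of _ j]) auto
          qed
          then have "sees ?J pos (\<lambda>v. pos v i) V x y \<longleftrightarrow> sees ?J pos (\<lambda>v. pos v i) C x y"
            by (rule sees_subset_iff[OF class_verts[OF C]])
          also have "\<dots> \<longleftrightarrow> sees ?J (a i C) (g i C) C x y"
          proof (rule sees_translate[OF xy, where t = "\<lambda>j. pos x j - a i C x j"])
            show "pos w j = a i C w j + (pos x j - a i C x j)" if "w \<in> C" "j \<in> ?J" for w j
              using in_class(2)[OF i C that(1) xy(1) that(2)] by linarith
            show "pos w i < pos z i \<longleftrightarrow> g i C w < g i C z" if "w \<in> C" "z \<in> C" for w z
            proof -
              have "pos z i - pos w i = (M * l i C) * (g i C z - g i C w)"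
                using in_class(1)[OF i C that(2,1)] .
              moreover have "0 < M * l i C" using \<open>0 < M\<close> l(1) by simp
              ultimately have "0 < pos z i - pos w i \<longleftrightarrow> 0 < g i C z - g i C w"
                using zero_less_mult_pos mult_pos_pos by metis
              then show ?thesis by simp
            qed
          qed
          finally show ?thesis .
        qed
        have "(u, v) \<in> sight_rel ?J pos (\<lambda>v. pos v i) V \<longleftrightarrow> (u, v) \<in> sight_rel ?J (a i C) (g i C) C"
          using sees uv class_verts[OF C] by (auto simp: sight_rel_def)
        then show ?thesis using rep[OF i C] uv by simp
      qed
      show ?thesis
      proof (rule set_eqI)
        fix e :: "'a \<times> 'a"
        obtain u v where [simp]: "e = (u, v)" by (cases e)
        show "e \<in> sight_rel ?J pos (\<lambda>v. pos v i) V \<longleftrightarrow> e \<in> R i"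
        proof (cases "u \<in> V \<and> v \<in> V \<and> (u, v) \<in> (R i)\<^sup>*")
          case True
          obtain C where C: "C \<in> classes i" "u \<in> C" using class_of[OF i, of u] True by blast
          then have "v \<in> C" using class_closed[OF i] True by blast
          then show ?thesis using within C by simp
        next
          case False
          have "\<not> sees ?J pos (\<lambda>v. pos v i) V u v \<and> \<not> sees ?J pos (\<lambda>v. pos v i) V v u"
            if uv: "u \<in> V" "v \<in> V"
          proof -
            obtain j where "j \<in> ?J" "1 < \<bar>pos u j - pos v j\<bar>"
              using separate[OF i uv] False uv by blast
            then show ?thesis
              using sees_overlap[of ?J pos _ V u v j] sees_overlap[of ?J pos _ V v u j] by fastforce
          qed
          then have "(u, v) \<notin> sight_rel ?J pos (\<lambda>v. pos v i) V" by (auto simp: sight_rel_def)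
          moreover have "(u, v) \<notin> R i" using False R_verts[OF i] by blast
          ultimately show ?thesis by simp
        qed
      qed
    qed
    then show "\<forall>i<n. sight_rel ({..<n} - {i}) pos (\<lambda>v. pos v i) V = R i" by blast
  qed
qed

end

section \<open>Connected parts of visibility trees and the final assembly\<close>

text \<open>Removing the objects outside \<open>C\<close> opens no new view from \<open>x\<close> to
  \<open>y\<close>. If \<open>x\<close> saw \<open>y\<close> already in \<open>W\<close>, that edge
  would be bypassed by a walk in \<open>R\<close> inside \<open>C\<close>. Otherwise
  \<open>x\<close> sees some \<open>w\<close> outside \<open>C\<close>, and the edge to
  \<open>w\<close> is bypassed by the chain from \<open>w\<close> to \<open>y\<close>, which avoids
  \<open>x\<close>, followed by a walk from \<open>y\<close> back to \<open>x\<close> inside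
  \<open>C\<close>, which avoids \<open>w\<close>.\<close>

lemma sight_rel_connected_part:
  assumes "all_bridges E" "sym E" "finite J" "finite W" "sight_rel J a h W \<subseteq> E"
    and "sym R" "R \<subseteq> sight_rel J a h W" "C \<subseteq> W"
    and conn: "\<And>x y. x \<in> C \<Longrightarrow> y \<in> C \<Longrightarrow> (x, y) \<in> (Restr R C)\<^sup>*"
  shows "sight_rel J a h C = Restr R C"
proof
  show "Restr R C \<subseteq> sight_rel J a h C"
    using sight_rel_subset[OF assms(8), of J a h] assms(7) by blast
  have "(x, y) \<in> R" if xy: "x \<in> C" "y \<in> C" and sees: "sees J a h C x y" for x y
  proof (rule ccontr)
    assume "(x, y) \<notin> R"
    have W: "x \<in> W" "y \<in> W" using xy assms(8) by auto
    from assms(3,4,8) W sees show False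
    proof (cases rule: sees_subset_cases)
      case 1
      then have "(x, y) \<in> E" using W assms(5) by (auto simp: sight_rel_def)
      moreover have "Restr R C \<subseteq> without_edge E x y"
        using assms(5-7) \<open>(x, y) \<notin> R\<close> by (auto dest: symD)
      then have "(x, y) \<in> (without_edge E x y)\<^sup>*" by (rule rtrancl_mono_in[OF conn[OF xy]])
      ultimately show False using assms(1) by (auto simp: all_bridges_def)
    next
      case (2 w)
      then have "(x, w) \<in> E" using W assms(5) by (auto simp: sight_rel_def)
      have "(w, y) \<in> (without_edge E x w)\<^sup>*"
        by (rule rtrancl_mono_in[OF 2(3)]) (use assms(5) in auto)
      moreover have "(y, x) \<in> (without_edge E x w)\<^sup>*"
        by (rule rtrancl_mono_in[OF conn[OF xy(2,1)]]) (use 2(1) assms(5,7) in auto)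
      ultimately have "(w, x) \<in> (without_edge E x w)\<^sup>*" by (rule rtrancl_trans)
      from rtrancl_symD[OF sym_without_edge[OF assms(2)] this]
      show False using assms(1) \<open>(x, w) \<in> E\<close> by (auto simp: all_bridges_def)
    qed
  qed
  then show "sight_rel J a h C \<subseteq> Restr R C"
    using assms(6) by (auto simp: sight_rel_def dest: symD)
qed

lemma forests_imp_cube_visibility:
  fixes F :: "nat \<Rightarrow> 'a pair_pre_digraph"
  assumes "1 \<le> n" and T: "is_tree T"
    and F: "\<And>i. i < n \<Longrightarrow> cube_orthogonal_visibility_forest (n - 1) (F i)"
    and union: "T = graph_Union (F ` {..<n})"
  shows "cube_visibility_graph n T"
proof -
  let ?V = "pverts T" and ?E = "parcs T"
  have G: "pair_graph T" using T by (simp add: is_tree_def)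
  have FG: "pair_graph (F i)" if "i < n" for i
    using F[OF that] by (simp add: cube_orthogonal_visibility_forest_def)
  have arcs: "?E = (\<Union>i<n. parcs (F i))" by (subst union) (simp add: graph_Union_def)
  \<comment> \<open>An edge that occurs in several forests keeps only its least colour, which makes
    the colours disjoint.\<close>
  define R where "R i = parcs (F i) - (\<Union>k<i. parcs (F k))" for i
  have E_eq: "?E = (\<Union>i<n. R i)"
  proof
    show "(\<Union>i<n. R i) \<subseteq> ?E" using arcs by (auto simp: R_def)
    show "?E \<subseteq> (\<Union>i<n. R i)"
    proof
      fix e assume "e \<in> ?E"
      then obtain i where "i < n" "e \<in> parcs (F i)" using arcs by blast
      define k where "k = (LEAST k. e \<in> parcs (F k))"
      have "e \<in> parcs (F k)" unfolding k_def by (rule LeastI[of _ i]) fact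
      moreover have "k \<le> i" unfolding k_def by (rule Least_le) fact
      moreover have "e \<notin> parcs (F j)" if "j < k" for j using that not_less_Least unfolding k_def by blast
      ultimately show "e \<in> (\<Union>i<n. R i)" using \<open>i < n\<close> by (auto simp: R_def intro!: bexI[of _ k])
    qed
  qed
  have sym_R: "sym (R i)" if "i < n" for i
  proof (rule symI)
    have swap: "(y, x) \<in> parcs (F k)" if "k < n" "(x, y) \<in> parcs (F k)" for k x y
      using pair_graph_sym[OF FG[OF that(1)]] that(2) by (rule symD)
    fix x y assume xy: "(x, y) \<in> R i"
    then have "(y, x) \<in> parcs (F i)" using swap[OF that] by (simp add: R_def)
    moreover have "(y, x) \<notin> parcs (F k)" if "k < i" for k
      using swap[of k y x] that \<open>i < n\<close> xy by (auto simp: R_def)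
    ultimately show "(y, x) \<in> R i" by (simp add: R_def)
  qed
  interpret edge_partition ?V ?E n R
  proof
    show "(u, v) \<in> ?E\<^sup>*" if "u \<in> ?V" "v \<in> ?V" for u v
      using T that connected_iff_rtrancl[OF G] by (simp add: is_tree_def)
    show "R i \<inter> R k = {}" if "i \<noteq> k" for i k
      using that by (cases i k rule: linorder_cases) (auto simp: R_def)
  qed (fact pair_graph_finite[OF G] pair_graph_arcs[OF G] pair_graph_sym[OF G]
      tree_all_bridges[OF T] sym_R E_eq)+
  have rep: "\<exists>p. inj_on (snd p) C \<and> sight_rel ({..<n} - {i}) (fst p) (snd p) C = Restr (R i) C"
    if i: "i < n" and C: "C \<in> classes i" for i C
  \<comment> \<open>Without edges \<open>C\<close> is a single vertex. It may be missing from
    \<open>F i\<close>, so a trivial representation is supplied instead of one taken from a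
    tree.\<close>
  proof (cases "Restr (R i) C = {}")
    case True
    have "x = y" if "x \<in> C" "y \<in> C" for x y
      using class_connected[OF i C that] True by simp
    then have "inj_on (\<lambda>_. 0 :: real) C" by (auto simp: inj_on_def)
    moreover have "sight_rel ({..<n} - {i}) (\<lambda>_ _. 0) (\<lambda>_. 0) C = {}"
      by (auto simp: sight_rel_def sees_def)
    ultimately show ?thesis using True by (intro exI[of _ "(\<lambda>_ _. 0, \<lambda>_. 0)"]) simp
  next
    case False
    obtain \<T> where trees: "\<forall>H\<in>\<T>. is_tree H \<and> cube_orthogonal_visibility_graph (n - 1) H"
      and disj: "disjoint_family_on pverts \<T>" and Fi: "F i = graph_Union \<T>"
      using F[OF i] unfolding cube_orthogonal_visibility_forest_def by blast
    have tree_arcs: "parcs H \<subseteq> pverts H \<times> pverts H" if "H \<in> \<T>" for H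
      using that trees pair_graph_arcs by (auto simp: is_tree_def)
    have Fi_arcs: "parcs (F i) = (\<Union>H\<in>\<T>. parcs H)" using Fi by (simp add: graph_Union_def)
    obtain v w where vw: "(v, w) \<in> Restr (R i) C" using False by auto
    then obtain H where H: "H \<in> \<T>" "(v, w) \<in> parcs H" using Fi_arcs by (auto simp: R_def)
    \<comment> \<open>The trees of the forest have disjoint vertex sets, so an edge of colour
      \<open>i\<close> that starts in \<open>H\<close> belongs to \<open>H\<close>. Hence
      \<open>C\<close> lies in the single tree \<open>H\<close>.\<close>
    have closed: "(x, y) \<in> parcs H" if xy: "x \<in> pverts H" "(x, y) \<in> R i" for x y
    proof -
      obtain H' where H': "H' \<in> \<T>" "(x, y) \<in> parcs H'" using xy(2) Fi_arcs by (auto simp: R_def)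
      then have "x \<in> pverts H'" using tree_arcs by blast
      then have "H' = H" using disj H(1) H'(1) xy(1) unfolding disjoint_family_on_def by blast
      then show ?thesis using H' by simp
    qed
    have v: "v \<in> C" "v \<in> pverts H" using vw tree_arcs[OF H(1)] H(2) by auto
    have C_sub: "C \<subseteq> pverts H"
    proof
      fix y assume "y \<in> C"
      then have "(v, y) \<in> (Restr (R i) C)\<^sup>*" using class_connected[OF i C v(1)] by blast
      then show "y \<in> pverts H"
        using rtrancl_restrict_closed[of v y _ "pverts H"] v(2) closed tree_arcs[OF H(1)] by blast
    qed
    have "cube_orthogonal_visibility_graph (n - 1) H" using trees H(1) by blast
    then obtain a h where HG: "pair_graph H" and sep: "separated ({..<n} - {i}) a h (pverts H)"
      and H_arcs: "parcs H = sight_rel ({..<n} - {i}) a h (pverts H)"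
      unfolding orthogonal_visibility_iff[OF i] by blast
    have "parcs H \<subseteq> ?E" using H(1) Fi_arcs arcs i by blast
    then have "sight_rel ({..<n} - {i}) a h C = Restr (Restr (R i) C) C"
      using H_arcs C_sub closed sym_Restr[OF i] bridges sym_E pair_graph_finite[OF HG]
        class_connected[OF i C]
      by (intro sight_rel_connected_part[where W = "pverts H" and E = ?E]) auto
    moreover have "finite C" using C_sub pair_graph_finite[OF HG] by (rule finite_subset)
    from injective_refinement[OF this, of h]
    obtain g :: "'a \<Rightarrow> real" where g: "inj_on g C" "\<forall>x\<in>C. \<forall>y\<in>C. h x < h y \<longrightarrow> g x < g y"
      by blast
    have "sees ({..<n} - {i}) a g C x y \<longleftrightarrow> sees ({..<n} - {i}) a h C x y" if "x \<in> C" "y \<in> C" for x y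
      using sees_refine_heights[OF separated_subset[OF sep C_sub] that g(2)[rule_format]] .
    then have "sight_rel ({..<n} - {i}) a g C = sight_rel ({..<n} - {i}) a h C"
      by (auto simp: sight_rel_def)
    ultimately show ?thesis using g(1) by (intro exI[of _ "(a, g)"]) auto
  qed
  define ag where "ag i C = (SOME p. inj_on (snd p) C \<and>
    sight_rel ({..<n} - {i}) (fst p) (snd p) C = Restr (R i) C)" for i C
  have ag: "inj_on (snd (ag i C)) C"
    "sight_rel ({..<n} - {i}) (fst (ag i C)) (snd (ag i C)) C = Restr (R i) C"
    if "i < n" "C \<in> classes i" for i C
    using someI_ex[OF rep[OF that]] unfolding ag_def by blast+
  have "0 < n" using \<open>1 \<le> n\<close> by simp
  obtain pos where pos: "\<forall>u\<in>?V. \<forall>v\<in>?V. u \<noteq> v \<longrightarrow> (\<exists>j<n. 1 < \<bar>pos u j - pos v j\<bar>)"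
    "\<forall>i<n. sight_rel ({..<n} - {i}) pos (\<lambda>v. pos v i) ?V = R i"
    using cube_positions[of "\<lambda>i C. snd (ag i C)" "\<lambda>i C. fst (ag i C)", OF \<open>0 < n\<close> ag] .
  have "?E = (\<Union>i<n. sight_rel ({..<n} - {i}) pos (\<lambda>v. pos v i) ?V)"
    using E_eq pos(2) by auto
  then show ?thesis unfolding cube_visibility_iff using G pos(1) by blast
qed

theorem theorem3:
  fixes T :: "'a pair_pre_digraph" and n :: nat
  assumes "1 \<le> n" and "is_tree T"
  shows "cube_visibility_graph n T \<longleftrightarrow>
    (\<exists>F :: nat \<Rightarrow> 'a pair_pre_digraph.
       (\<forall>i<n. subgraph (with_proj (F i)) (with_proj T) \<and>
              cube_orthogonal_visibility_forest (n - 1) (F i)) \<and>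
       T = graph_Union (F ` {..<n}))"
  using cube_visibility_imp_forests[OF assms] forests_imp_cube_visibility[OF assms] by blast

end
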